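(* Let $\xi\in\mathrm{ri}\,\mathcal U$ with $\mathcal U_\xi=[\underline\xi,\overline\xi]$, and assume $\underline\xi,\xi,\overline\xi\in\mathcal D$. Let $B^\xi\in\mathcal K(\Omega)$ be the $\mathbb P$-almost sure limit $$B^\xi(\omega,x,y)=\lim_{n\to\infty}\bigl(G_{x,v_n}(\omega)-G_{y,v_n}(\omega)\bigr),\quad x,y\in\mathbb Z^2,$$ for any sequence $v_n\in\mathbb Z_+^2$ with $|v_n|_1\to\infty$ and $\underline\xi\cdot e_1\le\varliminf_n \frac{v_n\cdot e_1}{|v_n|_1}\le\varlimsup_n\frac{v_n\cdot e_1}{|v_n|_1}\le\overline\xi\cdot e_1$ (this limit exists and satisfies $h(B^\xi)=-\nabla g_{\rm pp}(\xi)$). Define $F(\omega,x,y)=h(B^\xi)\cdot(x-y)-B^\xi(\omega,x,y)$. (i) Let $h=h(B^\xi)+(t,t)$ for some $t\in\mathbb R$. Then for $\mathbb P$-a.e. $\omega$ $$g_{\rm pl}(h)=\max_{i\in\{1,2\}}\{\omega_0+h\cdot e_i+F(\omega,0,e_i)\}=t.$$ In other words, $F$ is a minimizer in $$g_{\rm pl}(h)=\inf_{F\in\mathcal K_0(\Omega)}\ \mathbb P\text{-}\operatorname*{ess\,sup}_\omega\ \max_{i\in\{1,2\}}\{\omega_0+h\cdot e_i+F(\omega,0,e_i)\}$$ and the essential supremum disappears (the maximum is a.s. constant in $\omega$). (ii) For $\mathbb P$-a.e. $\omega$ $$g_{\rm pp}(\xi)=\max_{i\in\{1,2\}}\{\omega_0-B^\xi(\omega,0,e_i)-h(B^\xi)\cdot\xi\}=-h(B^\xi)\cdot\xi.$$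 In other words, $B^\xi$ is a minimizer in $$g_{\rm pp}(\xi)=\inf_{B\in\mathcal K(\Omega)}\ \mathbb P\text{-}\operatorname*{ess\,sup}_\omega\ \max_{i\in\{1,2\}}\{\omega_0-B(\omega,0,e_i)-h(B)\cdot\xi\}$$ and the essential supremum disappears.
   Context: **Setting.** $\Omega=\mathbb R^{\mathbb Z^2}$ with Borel $\sigma$-algebra, elements $\omega=(\omega_x)_{x\in\mathbb Z^2}$, translations $(T_x\omega)_y=\omega_{x+y}$. $\mathbb P$ is a Borel probability measure on $\Omega$ (expectation $\mathbb E$) under which $\{\omega_x\}$ are i.i.d., $\mathbb E[|\omega_0|^p]<\infty$ for some $p>2$, $\mathrm{Var}(\omega_0)>0$, and $\mathbb P(\omega_0\ge c)=1$ for some $c>-\infty$. $e_1=(1,0)$, $e_2=(0,1)$, $|x|_1=|x\cdot e_1|+|x\cdot e_2|$; $x\le y$ is coordinatewise. For $x\le y$ in $\mathbb Z^2$ the last-passage time is $G_{x,y}=\max\sum_{k=0}^{n-1}\omega_{x_k}$, the maximum over up-right paths (increments in $\{e_1,e_2\}$) $x=x_0,\dots,x_n=y$, $n=|y-x|_1$. For $h\in\mathbb R^2$, $G_n(h)=\max\{\sum_{k=0}^{n-1}\omega_{x_k}+h\cdot x_n\}$, the maximum over all $n$-step up-right paths with $x_0=0$. The a.s. limits $g_{\rm pp}(\xi)=\lim_{n}n^{-1}G_{0,\lfloor n\xi\rfloor}$ ($\xi\in\mathbb R_+^2$) and $g_{\rm pl}(h)=\lim_n n^{-1}G_n(h)$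 exist, are nonrandom and finite; $g_{\rm pp}$ is continuous, concave, symmetric and $1$-homogeneous. $\mathrm{ri}\,\mathcal U=\{te_1+(1-t)e_2:0<t<1\}$. **Regularity notions.** $\mathcal D$ is the set of $\xi\in\mathrm{ri}\,\mathcal U$ at which $g_{\rm pp}$ is differentiable. One-sided gradients at $\zeta\in\mathrm{ri}\,\mathcal U$: $\nabla g_{\rm pp}(\zeta\pm)\cdot e_1=\lim_{\varepsilon\searrow0}\frac{g_{\rm pp}(\zeta\pm\varepsilon e_1)-g_{\rm pp}(\zeta)}{\pm\varepsilon}$, $\nabla g_{\rm pp}(\zeta\pm)\cdot e_2=\lim_{\varepsilon\searrow0}\frac{g_{\rm pp}(\zeta\mp\varepsilon e_2)-g_{\rm pp}(\zeta)}{\mp\varepsilon}$. $\mathcal U_{\xi\pm}=\{\zeta\in\mathrm{ri}\,\mathcal U:g_{\rm pp}(\zeta)-g_{\rm pp}(\xi)=\nabla g_{\rm pp}(\xi\pm)\cdot(\zeta-\xi)\}$ and $\mathcal U_\xi=\mathcal U_{\xi-}\cup\mathcal U_{\xi+}=[\underline\xi,\overline\xi]$ (closed line segment) with $\underline\xi\cdot e_1\le\overline\xi\cdot e_1$. **Cocycles.** A measurable $B:\Omega\times\mathbb Z^2\times\mathbb Z^2\to\mathbb R$ is a stationary $L^1(\mathbb P)$ cocycle if (a) $\mathbb E|B(0,e_i)|<\infty$ for $i=1,2$; (b) for $\mathbb P$-a.e. $\omega$ and all $x,y,z$: $B(\omega,z+x,z+y)=B(T_z\omega,x,y)$; (c)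 for $\mathbb P$-a.e. $\omega$ and all $x,y,z$: $B(\omega,x,y)+B(\omega,y,z)=B(\omega,x,z)$. $\mathcal K(\Omega)$ is the space of these; $\mathcal K_0(\Omega)$ is the subspace of those with $\mathbb E[B(x,y)]=0$ for all $x,y$. For $B\in\mathcal K(\Omega)$, $h(B)\in\mathbb R^2$ is defined by $\mathbb E[B(0,e_i)]=-h(B)\cdot e_i$, $i=1,2$. The two displayed variational formulas (infima over $\mathcal K_0(\Omega)$ and $\mathcal K(\Omega)$) are known identities, valid for all $h\in\mathbb R^2$ and $\xi\in\mathrm{ri}\,\mathcal U$. *)

theory Defs
  imports "HOL-Probability.Probability"
begin

type_synonym site = "int \<times> int"
type_synonym env = "site \<Rightarrow> real"

definition e1 :: site where "e1 = (1, 0)"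
definition e2 :: site where "e2 = (0, 1)"

definition vec_of :: "site \<Rightarrow> real \<times> real" where
  "vec_of x = (real_of_int (fst x), real_of_int (snd x))"

definition floor_site :: "real \<times> real \<Rightarrow> site" where
  "floor_site \<zeta> = (\<lfloor>fst \<zeta>\<rfloor>, \<lfloor>snd \<zeta>\<rfloor>)"

definition l1 :: "site \<Rightarrow> int" where
  "l1 x = \<bar>fst x\<bar> + \<bar>snd x\<bar>"

definition shift :: "site \<Rightarrow> env \<Rightarrow> env" where
  "shift x \<omega> = (\<lambda>y. \<omega> (x + y))"

text \<open>The topology on \<^typ>\<open>env\<close> is the product topology, so \<^term>\<open>borel :: env measure\<close>
  is the Borel sigma-algebra of the product space.\<close>

locale iid_environment = prob_space P for P :: "env measure" +
  assumes sets_P: "sets P = sets borel"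
    and indep: "indep_vars (\<lambda>_. borel) (\<lambda>x \<omega>. \<omega> x) UNIV"
    and identically_distributed: "\<And>x. distr P borel (\<lambda>\<omega>. \<omega> x) = distr P borel (\<lambda>\<omega>. \<omega> 0)"
    and moment: "\<exists>p>2. integrable P (\<lambda>\<omega>. \<bar>\<omega> 0\<bar> powr p)"
    and variance_pos: "variance (\<lambda>\<omega>. \<omega> 0) > 0"
    and bounded_below: "\<exists>c. AE \<omega> in P. c \<le> \<omega> 0"

text \<open>Only the first \<open>n + 1\<close> values of the sequence are constrained; the later ones are irrelevant.\<close>

definition up_right_path :: "nat \<Rightarrow> (nat \<Rightarrow> site) \<Rightarrow> bool" where
  "up_right_path n p \<longleftrightarrow> (\<forall>k<n. p (Suc k) - p k \<in> {e1, e2})"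

text \<open>The last-passage time from \<open>x\<close> to \<open>y\<close>; it excludes the weight at \<open>y\<close> and is meaningful
  only when \<open>x \<le> y\<close> coordinatewise (otherwise there is no path and the value is unspecified).\<close>

definition last_passage :: "env \<Rightarrow> site \<Rightarrow> site \<Rightarrow> real" where
  "last_passage \<omega> x y = (let n = nat (l1 (y - x)) in
     Max {\<Sum>k<n. \<omega> (p k) | p. up_right_path n p \<and> p 0 = x \<and> p n = y})"

definition last_passage_line :: "env \<Rightarrow> nat \<Rightarrow> real \<times> real \<Rightarrow> real" where
  "last_passage_line \<omega> n h =
     Max {(\<Sum>k<n. \<omega> (p k)) + h \<bullet> vec_of (p n) | p. up_right_path n p \<and> p 0 = 0}"

definition is_pp_limit :: "env measure \<Rightarrow> real \<times> real \<Rightarrow> real \<Rightarrow> bool" where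
  "is_pp_limit P \<zeta> r \<longleftrightarrow>
     (AE \<omega> in P. (\<lambda>n. last_passage \<omega> 0 (floor_site (real n *\<^sub>R \<zeta>)) / real n) \<longlonglongrightarrow> r)"

definition is_pl_limit :: "env measure \<Rightarrow> real \<times> real \<Rightarrow> real \<Rightarrow> bool" where
  "is_pl_limit P h r \<longleftrightarrow>
     (AE \<omega> in P. (\<lambda>n. last_passage_line \<omega> n h / real n) \<longlonglongrightarrow> r)"

definition gpp :: "env measure \<Rightarrow> real \<times> real \<Rightarrow> real" where
  "gpp P \<zeta> = (THE r. is_pp_limit P \<zeta> r)"

definition gpl :: "env measure \<Rightarrow> real \<times> real \<Rightarrow> real" where
  "gpl P h = (THE r. is_pl_limit P h r)"

definition riU :: "(real \<times> real) set" where
  "riU = {t *\<^sub>R vec_of e1 + (1 - t) *\<^sub>R vec_of e2 | t. 0 < t \<and> t < 1}"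

definition Diff_set :: "env measure \<Rightarrow> (real \<times> real) set" where
  "Diff_set P = {\<zeta> \<in> riU. gpp P differentiable (at \<zeta>)}"

text \<open>One-sided gradients \<open>\<nabla>g(\<zeta>+)\<close> and \<open>\<nabla>g(\<zeta>-)\<close>: the sign refers to the direction of motion
  along the simplex, hence the second coordinate is perturbed with the opposite sign.\<close>

definition grad_plus :: "env measure \<Rightarrow> real \<times> real \<Rightarrow> real \<times> real" where
  "grad_plus P \<zeta> =
    (Lim (at_right 0) (\<lambda>\<epsilon>. (gpp P (\<zeta> + \<epsilon> *\<^sub>R vec_of e1) - gpp P \<zeta>) / \<epsilon>),
     Lim (at_right 0) (\<lambda>\<epsilon>. (gpp P (\<zeta> - \<epsilon> *\<^sub>R vec_of e2) - gpp P \<zeta>) / (- \<epsilon>)))"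

definition grad_minus :: "env measure \<Rightarrow> real \<times> real \<Rightarrow> real \<times> real" where
  "grad_minus P \<zeta> =
    (Lim (at_right 0) (\<lambda>\<epsilon>. (gpp P (\<zeta> - \<epsilon> *\<^sub>R vec_of e1) - gpp P \<zeta>) / (- \<epsilon>)),
     Lim (at_right 0) (\<lambda>\<epsilon>. (gpp P (\<zeta> + \<epsilon> *\<^sub>R vec_of e2) - gpp P \<zeta>) / \<epsilon>))"

definition U_plus :: "env measure \<Rightarrow> real \<times> real \<Rightarrow> (real \<times> real) set" where
  "U_plus P \<xi> = {\<zeta> \<in> riU. gpp P \<zeta> - gpp P \<xi> = grad_plus P \<xi> \<bullet> (\<zeta> - \<xi>)}"

definition U_minus :: "env measure \<Rightarrow> real \<times> real \<Rightarrow> (real \<times> real) set" where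
  "U_minus P \<xi> = {\<zeta> \<in> riU. gpp P \<zeta> - gpp P \<xi> = grad_minus P \<xi> \<bullet> (\<zeta> - \<xi>)}"

definition U_set :: "env measure \<Rightarrow> real \<times> real \<Rightarrow> (real \<times> real) set" where
  "U_set P \<xi> = U_minus P \<xi> \<union> U_plus P \<xi>"

definition cocycles :: "env measure \<Rightarrow> (env \<Rightarrow> site \<Rightarrow> site \<Rightarrow> real) set" where
  "cocycles P = {B.
     (\<lambda>(\<omega>, x, y). B \<omega> x y) \<in> borel_measurable (P \<Otimes>\<^sub>M count_space UNIV \<Otimes>\<^sub>M count_space UNIV) \<and>
     (\<forall>e\<in>{e1, e2}. integrable P (\<lambda>\<omega>. B \<omega> 0 e)) \<and>
     (AE \<omega> in P. \<forall>x y z. B \<omega> (z + x) (z + y) = B (shift z \<omega>) x y) \<and>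
     (AE \<omega> in P. \<forall>x y z. B \<omega> x y + B \<omega> y z = B \<omega> x z)}"

definition cocycles0 :: "env measure \<Rightarrow> (env \<Rightarrow> site \<Rightarrow> site \<Rightarrow> real) set" where
  "cocycles0 P = {B \<in> cocycles P. \<forall>x y. (\<integral>\<omega>. B \<omega> x y \<partial>P) = 0}"

definition hvec :: "env measure \<Rightarrow> (env \<Rightarrow> site \<Rightarrow> site \<Rightarrow> real) \<Rightarrow> real \<times> real" where
  "hvec P B = (- (\<integral>\<omega>. B \<omega> 0 e1 \<partial>P), - (\<integral>\<omega>. B \<omega> 0 e2 \<partial>P))"

text \<open>Sequences whose asymptotic directions lie between \<open>\<xi>\<^sub>1\<close> and \<open>\<xi>\<^sub>2\<close>;
  the limits inferior and superior are taken in the extended reals.\<close>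

definition directed_between :: "real \<times> real \<Rightarrow> real \<times> real \<Rightarrow> (nat \<Rightarrow> site) \<Rightarrow> bool" where
  "directed_between \<xi>\<^sub>1 \<xi>\<^sub>2 v \<longleftrightarrow>
     (\<forall>n. 0 \<le> fst (v n) \<and> 0 \<le> snd (v n)) \<and>
     filterlim (\<lambda>n. l1 (v n)) at_top sequentially \<and>
     ereal (fst \<xi>\<^sub>1) \<le> liminf (\<lambda>n. ereal (real_of_int (fst (v n)) / real_of_int (l1 (v n)))) \<and>
     limsup (\<lambda>n. ereal (real_of_int (fst (v n)) / real_of_int (l1 (v n)))) \<le> ereal (fst \<xi>\<^sub>2)"

definition pl_max :: "real \<times> real \<Rightarrow> (env \<Rightarrow> site \<Rightarrow> site \<Rightarrow> real) \<Rightarrow> env \<Rightarrow> real" where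
  "pl_max h F \<omega> = (MAX e\<in>{e1, e2}. \<omega> 0 + h \<bullet> vec_of e + F \<omega> 0 e)"

definition pp_max ::
  "env measure \<Rightarrow> real \<times> real \<Rightarrow> (env \<Rightarrow> site \<Rightarrow> site \<Rightarrow> real) \<Rightarrow> env \<Rightarrow> real" where
  "pp_max P \<xi> B \<omega> = (MAX e\<in>{e1, e2}. \<omega> 0 - B \<omega> 0 e - hvec P B \<bullet> \<xi>)"

end

theory Submission
  imports Defs
begin

text \<open>
  Up-right paths lose exactly one weight at the first step, so for \<open>v\<close> far away
  \<open>G\<^bsub>0,v\<^esub> = \<omega>\<^sub>0 + max\<^sub>i G\<^bsub>e\<^sub>i,v\<^esub>\<close>. Dividing the weight out and letting \<open>v\<close> go to infinity in
  direction \<open>\<xi>\<close> turns this into \<open>max\<^sub>i (\<omega>\<^sub>0 - B(0,e\<^sub>i)) = 0\<close> almost surely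
  (\<open>busemann_recovers_weight\<close>). Both maxima in the theorem are this one plus a constant, which is
  why no essential supremum survives: the first is \<open>t\<close> and the second is \<open>-h(B) \<bullet> \<xi>\<close>.

  It remains to recognise the constants. Since \<open>g\<^sub>p\<^sub>p\<close> is homogeneous, Euler's identity
  (\<open>gpp_Euler\<close>) gives \<open>g\<^sub>p\<^sub>p(\<xi>) = \<nabla>g\<^sub>p\<^sub>p(\<xi>) \<bullet> \<xi> = -h(B) \<bullet> \<xi>\<close>. For \<open>g\<^sub>p\<^sub>l\<close> there are two
  inequalities. Following an optimal path in direction \<open>\<xi>\<close> gives
  \<open>g\<^sub>p\<^sub>p(\<xi>) + h \<bullet> \<xi> \<le> g\<^sub>p\<^sub>l(h)\<close> (\<open>gpp_add_inner_le_gpl\<close>), hence \<open>t \<le> g\<^sub>p\<^sub>l(h)\<close>. The upper bound is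
  the easy half of the variational formula (\<open>gpl_le_cocycle_bound\<close>): if a centred cocycle \<open>F\<close>
  satisfies \<open>max\<^sub>i (\<omega>\<^sub>0 + h \<bullet> e\<^sub>i + F(0,e\<^sub>i)) \<le> C\<close> almost surely, then \<open>g\<^sub>p\<^sub>l(h) \<le> C\<close>. The same
  lemma, applied to competing cocycles, proves that no competitor does better; for the point-to-point
  formula the competitor is first centred and the two limit shapes are compared by the duality
  inequality.

  The upper bound telescopes along a path: the weight of an \<open>n\<close>-step path to \<open>x\<close> is at most
  \<open>n C - F(0,x)\<close>, so one needs \<open>-F(0,x) \<le> o(n)\<close> uniformly in \<open>x\<close>. Here the lower bound on the
  weights enters. It makes \<open>F(x,x + e\<^sub>i)\<close> bounded above, so \<open>-F(0,\<cdot>)\<close> decreases at most linearly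
  in either coordinate, and its values on the antidiagonal at distance \<open>K N\<close> are controlled by its
  values at \<open>K + 2\<close> grid points up to an error \<open>c N\<close> (\<open>neg_cocycle_le_grid\<close>). At each of these
  fixed directions an \<open>L\<^sup>1\<close> ergodic theorem applies; letting \<open>N\<close> and then \<open>K\<close> tend to infinity
  finishes the argument. The ergodic theorem (\<open>mean_ergodic_integrable\<close>) is proved directly from
  independence: it holds for cylinder events by a variance bound, it passes to all events by a
  \<open>\<pi>\<close>-\<open>\<lambda>\<close> argument, and it passes to integrable functions because averaging along a shift is an
  \<open>L\<^sup>1\<close> contraction.
\<close>

section \<open>Up-right paths and last-passage times\<close>

lemma up_right_path_Suc:
  "up_right_path (Suc n) p \<longleftrightarrow> up_right_path n p \<and> p (Suc n) - p n \<in> {e1, e2}"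
  unfolding up_right_path_def by (auto simp: less_Suc_eq)

lemma up_right_path_Suc_shift:
  "up_right_path (Suc n) p \<longleftrightarrow> p 1 - p 0 \<in> {e1, e2} \<and> up_right_path n (\<lambda>k. p (Suc k))"
  unfolding up_right_path_def by (auto simp: All_less_Suc2)

lemma up_right_path_coords:
  assumes "up_right_path n p" "k \<le> n"
  shows "fst (p 0) \<le> fst (p k) \<and> snd (p 0) \<le> snd (p k) \<and>
    fst (p k) + snd (p k) = fst (p 0) + snd (p 0) + int k"
  using assms(2)
proof (induction k)
  case (Suc k)
  then have "p (Suc k) - p k \<in> {e1, e2}"
    using assms(1) by (auto simp: up_right_path_def)
  then have "p (Suc k) = p k + e1 \<or> p (Suc k) = p k + e2"
    by (auto simp: algebra_simps)
  then show ?case using Suc by (auto simp: e1_def e2_def)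
qed simp

text \<open>Paths are functions on all of \<open>\<nat>\<close>, hence there are infinitely many of them; only the values
  that they produce form a finite set. This is what makes \<open>Max\<close> meaningful in the last-passage
  times.\<close>

lemma finite_path_values:
  "finite {(\<Sum>k<n. \<omega> (p k), p n) | p. up_right_path n p \<and> p 0 = x}"
proof (induction n)
  case 0
  have "{(\<Sum>k<0. \<omega> (p k), p 0) | p. up_right_path 0 p \<and> p 0 = x} \<subseteq> {(0, x)}" by auto
  then show ?case using finite_subset by blast
next
  case (Suc n)
  let ?S = "{(\<Sum>k<n. \<omega> (p k), p n) | p. up_right_path n p \<and> p 0 = x}"
  let ?f = "\<lambda>((s, z), e). (s + \<omega> z, z + e)"
  have "{(\<Sum>k<Suc n. \<omega> (p k), p (Suc n)) | p. up_right_path (Suc n) p \<and> p 0 = x}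
    \<subseteq> ?f ` (?S \<times> {e1, e2})"
  proof
    fix v assume "v \<in> {(\<Sum>k<Suc n. \<omega> (p k), p (Suc n)) | p. up_right_path (Suc n) p \<and> p 0 = x}"
    then obtain p where p: "up_right_path (Suc n) p" "p 0 = x"
      and v: "v = (\<Sum>k<Suc n. \<omega> (p k), p (Suc n))" by auto
    show "v \<in> ?f ` (?S \<times> {e1, e2})"
    proof (rule image_eqI)
      show "v = ?f ((\<Sum>k<n. \<omega> (p k), p n), p (Suc n) - p n)" by (simp add: v)
      show "((\<Sum>k<n. \<omega> (p k), p n), p (Suc n) - p n) \<in> ?S \<times> {e1, e2}"
        using p by (intro SigmaI) (auto simp: up_right_path_Suc)
    qed
  qed
  moreover have "finite (?f ` (?S \<times> {e1, e2}))" using Suc by simp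
  ultimately show ?case by (rule finite_subset)
qed

lemma finite_point_values:
  "finite {\<Sum>k<n. \<omega> (p k) | p. up_right_path n p \<and> p 0 = x \<and> p n = y}"
proof -
  have "{\<Sum>k<n. \<omega> (p k) | p. up_right_path n p \<and> p 0 = x \<and> p n = y}
      \<subseteq> fst ` {(\<Sum>k<n. \<omega> (p k), p n) | p. up_right_path n p \<and> p 0 = x}"
    unfolding setcompr_eq_image image_image by auto
  then show ?thesis by (rule finite_subset[OF _ finite_imageI[OF finite_path_values]])
qed

lemma finite_line_values:
  "finite {(\<Sum>k<n. \<omega> (p k)) + h \<bullet> vec_of (p n) | p. up_right_path n p \<and> p 0 = 0}"
proof -
  have "{(\<Sum>k<n. \<omega> (p k)) + h \<bullet> vec_of (p n) | p. up_right_path n p \<and> p 0 = 0}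
      = (\<lambda>(s, z). s + h \<bullet> vec_of z) `
        {(\<Sum>k<n. \<omega> (p k), p n) | p. up_right_path n p \<and> p 0 = 0}"
    unfolding setcompr_eq_image image_image by simp
  then show ?thesis by (simp only: finite_imageI[OF finite_path_values])
qed

lemma up_right_path_exists:
  assumes "fst x \<le> fst y" "snd x \<le> snd y"
  shows "\<exists>p. up_right_path (nat (l1 (y - x))) p \<and> p 0 = x \<and> p (nat (l1 (y - x))) = y"
proof -
  define m where "m = nat (fst y - fst x)"
  define n where "n = nat (snd y - snd x)"
  define p where "p k = (fst x + int (min k m), snd x + int (k - m))" for k
  have len: "nat (l1 (y - x)) = m + n"
    using assms by (simp add: l1_def m_def n_def)
  have "up_right_path (m + n) p"
    unfolding up_right_path_def by (auto simp: p_def e1_def e2_def Suc_diff_le min_def)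
  moreover have "p 0 = x" "p (m + n) = y"
    using assms by (auto simp: p_def m_def n_def prod_eq_iff)
  ultimately show ?thesis using len by metis
qed

lemma last_passage_le_iff:
  assumes "fst x \<le> fst y" "snd x \<le> snd y"
  shows "last_passage \<omega> x y \<le> a \<longleftrightarrow>
    (\<forall>p. up_right_path (nat (l1 (y - x))) p \<and> p 0 = x \<and> p (nat (l1 (y - x))) = y
      \<longrightarrow> (\<Sum>k<nat (l1 (y - x)). \<omega> (p k)) \<le> a)"
  unfolding last_passage_def Let_def
  using up_right_path_exists[OF assms]
  by (subst Max_le_iff[OF finite_point_values]) auto

lemma last_passage_ge:
  assumes "up_right_path n p" "p 0 = x" "p n = y"
  shows "(\<Sum>k<n. \<omega> (p k)) \<le> last_passage \<omega> x y"
proof -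
  have c: "fst x \<le> fst y \<and> snd x \<le> snd y \<and> fst y + snd y = fst x + snd x + int n"
    using up_right_path_coords[OF assms(1), of n] assms(2,3) by auto
  then have "nat (l1 (y - x)) = n" by (auto simp: l1_def)
  then show ?thesis
    using last_passage_le_iff[of x y \<omega> "last_passage \<omega> x y"] c assms by auto
qed

lemma last_passage_line_le_iff:
  "last_passage_line \<omega> n h \<le> a \<longleftrightarrow>
    (\<forall>p. up_right_path n p \<and> p 0 = 0 \<longrightarrow> (\<Sum>k<n. \<omega> (p k)) + h \<bullet> vec_of (p n) \<le> a)"
proof -
  have "up_right_path n (\<lambda>k. (int k, 0))" by (simp add: up_right_path_def e1_def)
  then have "\<exists>p. up_right_path n p \<and> p 0 = 0"
    by (metis (no_types) of_nat_0 zero_prod_def)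
  then show ?thesis
    unfolding last_passage_line_def
    by (subst Max_le_iff[OF finite_line_values]) auto
qed

text \<open>A path to a prescribed endpoint competes in the point-to-line problem of the same length.\<close>

lemma last_passage_line_ge_last_passage:
  assumes "0 \<le> fst y" "0 \<le> snd y"
  shows "last_passage \<omega> 0 y + h \<bullet> vec_of y \<le> last_passage_line \<omega> (nat (l1 y)) h"
proof -
  have "last_passage \<omega> 0 y \<le> last_passage_line \<omega> (nat (l1 y)) h - h \<bullet> vec_of y"
    using assms last_passage_line_le_iff[of \<omega> "nat (l1 y)" h "last_passage_line \<omega> (nat (l1 y)) h"]
    by (subst last_passage_le_iff) (auto simp: le_diff_eq)
  then show ?thesis by simp
qed

text \<open>Dynamic programming: a path first collects the weight at its starting point and then is
  an optimal path from one of the two neighbours.\<close>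

text \<open>Dynamic programming: a path collects the weight at its starting point and then is a path from
  one of the two neighbours. Strict inequalities ensure that both neighbours can reach \<open>y\<close>.\<close>

lemma last_passage_first_step:
  assumes "fst x < fst y" "snd x < snd y"
  shows "last_passage \<omega> x y = \<omega> x + (MAX e\<in>{e1, e2}. last_passage \<omega> (x + e) y)"
proof (rule antisym)
  let ?M = "MAX e\<in>{e1, e2}. last_passage \<omega> (x + e) y"
  let ?n = "nat (l1 (y - x))"
  obtain n where n: "?n = Suc n"
    using assms by (cases ?n) (auto simp: l1_def)
  show "last_passage \<omega> x y \<le> \<omega> x + ?M"
  proof (subst last_passage_le_iff)
    show "fst x \<le> fst y" "snd x \<le> snd y" using assms by auto
    show "\<forall>p. up_right_path ?n p \<and> p 0 = x \<and> p ?n = y \<longrightarrow> (\<Sum>k<?n. \<omega> (p k)) \<le> \<omega> x + ?M"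
    proof (intro allI impI, elim conjE)
      fix p assume p: "up_right_path ?n p" "p 0 = x" "p ?n = y"
      then have q: "up_right_path n (\<lambda>k. p (Suc k))" "p 1 - p 0 \<in> {e1, e2}"
        unfolding n up_right_path_Suc_shift by auto
      have "(\<Sum>k<n. \<omega> (p (Suc k))) \<le> last_passage \<omega> (x + (p 1 - p 0)) y"
        using p n by (intro last_passage_ge[OF q(1)]) auto
      also have "\<dots> \<le> ?M" using q(2) by (intro Max_ge) auto
      finally show "(\<Sum>k<?n. \<omega> (p k)) \<le> \<omega> x + ?M"
        unfolding n using p(2) by (simp only: sum.lessThan_Suc_shift)
    qed
  qed
  have "last_passage \<omega> (x + e) y \<le> last_passage \<omega> x y - \<omega> x" if e: "e \<in> {e1, e2}" for e
  proof (subst last_passage_le_iff)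
    show "fst (x + e) \<le> fst y" "snd (x + e) \<le> snd y"
      using assms e by (auto simp: e1_def e2_def)
    have len: "nat (l1 (y - (x + e))) = n"
      using n assms e by (auto simp: l1_def e1_def e2_def)
    show "\<forall>p. up_right_path (nat (l1 (y - (x + e)))) p \<and> p 0 = x + e \<and> p (nat (l1 (y - (x + e)))) = y
      \<longrightarrow> (\<Sum>k<nat (l1 (y - (x + e))). \<omega> (p k)) \<le> last_passage \<omega> x y - \<omega> x"
      unfolding len
    proof (intro allI impI, elim conjE)
      fix p assume p: "up_right_path n p" "p 0 = x + e" "p n = y"
      define q where "q k = (case k of 0 \<Rightarrow> x | Suc j \<Rightarrow> p j)" for k
      have "(\<Sum>k<Suc n. \<omega> (q k)) \<le> last_passage \<omega> x y"
        using p e by (intro last_passage_ge) (auto simp: up_right_path_Suc_shift q_def)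
      moreover have "(\<Sum>k<Suc n. \<omega> (q k)) = \<omega> x + (\<Sum>k<n. \<omega> (p k))"
        by (subst sum.lessThan_Suc_shift) (simp add: q_def)
      ultimately show "(\<Sum>k<n. \<omega> (p k)) \<le> last_passage \<omega> x y - \<omega> x"
        by simp
    qed
  qed
  then show "\<omega> x + ?M \<le> last_passage \<omega> x y" by (simp add: max_def le_diff_eq add.commute)
qed

section \<open>Shift invariance of an i.i.d. environment\<close>

definition multiple :: "nat \<Rightarrow> site \<Rightarrow> site" where
  "multiple k z = (int k * fst z, int k * snd z)"

definition cylinder :: "site set \<Rightarrow> (site \<Rightarrow> real set) \<Rightarrow> env set" where
  "cylinder J E = {\<omega>. \<forall>x\<in>J. \<omega> x \<in> E x}"

lemma tendsto_zero_dominated: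
  fixes a b :: "nat \<Rightarrow> real"
  assumes "\<And>n. 0 \<le> a n" "\<And>n. a n \<le> b n" "b \<longlonglongrightarrow> 0"
  shows "a \<longlonglongrightarrow> 0"
  by (rule tendsto_sandwich[OF _ _ tendsto_const assms(3)]) (simp_all add: assms(1,2))

lemma cylinder_Int_disjoint:
  assumes "J \<inter> J' = {}"
  shows "cylinder J E \<inter> cylinder J' E' = cylinder (J \<union> J') (\<lambda>y. if y \<in> J then E y else E' y)"
  using assms by (auto simp: cylinder_def)

lemma sigma_sets_cylinders:
  "sets (borel :: env measure) =
    sigma_sets UNIV {cylinder J E | J E. finite J \<and> (\<forall>x\<in>J. E x \<in> sets borel)}" (is "_ = sigma_sets _ ?G")
proof
  have 1: "sets (borel :: env measure) =
      sigma_sets UNIV {{f. f i \<in> A} | (i::site) A. A \<in> sets (borel :: real measure)}"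
    by (subst sets_PiM_equal_borel[symmetric], subst sets_PiM_single) auto
  show "sets (borel :: env measure) \<subseteq> sigma_sets UNIV ?G"
    unfolding 1
  proof (rule sigma_sets_mono', clarify)
    fix i :: site and A assume "A \<in> sets (borel :: real measure)"
    moreover have "{f. f i \<in> A} = cylinder {i} (\<lambda>_. A)" by (auto simp: cylinder_def)
    ultimately show "\<exists>J E. {f. f i \<in> A} = cylinder J E \<and> finite J \<and> (\<forall>x\<in>J. E x \<in> sets borel)"
      by (intro exI[of _ "{i}"] exI[of _ "\<lambda>_. A"]) simp
  qed
  have "cylinder J E \<in> sets borel" if "finite J" "\<forall>x\<in>J. E x \<in> sets (borel :: real measure)" for J E
  proof -
    have "cylinder J E = (\<Inter>x\<in>J. (\<lambda>\<omega>. \<omega> x) -` E x \<inter> space (borel :: env measure))" if "J \<noteq> {}"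
      using that by (auto simp: cylinder_def)
    moreover have "(\<lambda>\<omega>. \<omega> x) -` E x \<inter> space borel \<in> sets (borel :: env measure)" if "x \<in> J" for x
      using that \<open>\<forall>x\<in>J. _\<close> by (intro measurable_sets[OF borel_measurable_continuous_onI]) auto
    ultimately show ?thesis
      using \<open>finite J\<close> by (cases "J = {}") (auto simp: cylinder_def)
  qed
  then show "sigma_sets UNIV ?G \<subseteq> sets (borel :: env measure)"
    using sets.sigma_sets_subset[of ?G "borel :: env measure"] by auto
qed

lemma Int_stable_cylinders:
  "Int_stable {cylinder J E | J E. finite J \<and> (\<forall>x\<in>J. E x \<in> sets (borel :: real measure))}"
proof (rule Int_stableI, safe)
  fix J J' :: "site set" and E E' :: "site \<Rightarrow> real set"
  assume fin: "finite J" "finite J'"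
    and E: "\<forall>x\<in>J. E x \<in> sets borel" "\<forall>x\<in>J'. E' x \<in> sets borel"
  let ?E = "\<lambda>x. (if x \<in> J then E x else UNIV) \<inter> (if x \<in> J' then E' x else UNIV)"
  have "cylinder J E \<inter> cylinder J' E' = cylinder (J \<union> J') ?E"
    by (auto simp: cylinder_def split: if_splits)
  moreover have "\<forall>x\<in>J \<union> J'. ?E x \<in> sets borel" using E by auto
  ultimately show "\<exists>J'' E''. cylinder J E \<inter> cylinder J' E' = cylinder J'' E'' \<and>
      finite J'' \<and> (\<forall>x\<in>J''. E'' x \<in> sets borel)"
    using fin by (intro exI[of _ "J \<union> J'"] exI[of _ ?E]) simp
qed

context iid_environment
begin

lemma space_P [simp]: "space P = UNIV"
  using sets_eq_imp_space_eq[OF sets_P] by simp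

lemma prob_UNIV [simp]: "prob UNIV = 1"
  using prob_space by simp

lemma measurable_P_iff: "measurable P M = measurable borel M"
  by (rule measurable_cong_sets[OF sets_P refl])

lemma measurable_coordinate [measurable]: "(\<lambda>\<omega>. \<omega> x) \<in> borel_measurable P"
  unfolding measurable_P_iff by (intro borel_measurable_continuous_onI) simp

lemma measurable_shift [measurable]: "shift z \<in> measurable P P"
proof -
  have "(\<lambda>\<omega> y. \<omega> (z + y)) \<in> borel_measurable P"
    by (rule measurable_coordinatewise_then_product) (rule measurable_coordinate)
  moreover have "shift z = (\<lambda>\<omega> y. \<omega> (z + y))" by (simp add: shift_def fun_eq_iff)
  ultimately show ?thesis
    unfolding measurable_cong_sets[OF refl sets_P] by simp
qed

lemma cylinder_sets:
  assumes "finite J" "\<forall>x\<in>J. E x \<in> sets borel"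
  shows "cylinder J E \<in> sets P"
  using assms unfolding sets_P sigma_sets_cylinders by (intro sigma_sets.Basic) auto

lemma prob_cylinder:
  assumes "finite J" "\<forall>x\<in>J. E x \<in> sets borel"
  shows "prob (cylinder J E) = (\<Prod>x\<in>J. prob {\<omega>. \<omega> 0 \<in> E x})"
proof (cases "J = {}")
  case True
  then show ?thesis using prob_space by (simp add: cylinder_def)
next
  case False
  have "prob (\<Inter>x\<in>J. (\<lambda>\<omega>. \<omega> x) -` E x \<inter> space P)
      = (\<Prod>x\<in>J. prob ((\<lambda>\<omega>. \<omega> x) -` E x \<inter> space P))"
    using assms False by (intro indep_varsD[OF indep]) auto
  also have "(\<Inter>x\<in>J. (\<lambda>\<omega>. \<omega> x) -` E x \<inter> space P) = cylinder J E"
    using False by (auto simp: cylinder_def)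
  also have "(\<Prod>x\<in>J. prob ((\<lambda>\<omega>. \<omega> x) -` E x \<inter> space P)) = (\<Prod>x\<in>J. prob {\<omega>. \<omega> 0 \<in> E x})"
  proof (rule prod.cong[OF refl])
    fix x assume x: "x \<in> J"
    have "measure (distr P borel (\<lambda>\<omega>. \<omega> x)) (E x) = measure (distr P borel (\<lambda>\<omega>. \<omega> 0)) (E x)"
      by (subst identically_distributed[of x]) simp
    then show "prob ((\<lambda>\<omega>. \<omega> x) -` E x \<inter> space P) = prob {\<omega>. \<omega> 0 \<in> E x}"
      using x assms by (simp add: measure_distr vimage_def)
  qed
  finally show ?thesis .
qed

lemma shift_vimage_cylinder:
  "shift z -` cylinder J E = cylinder ((+) z ` J) (\<lambda>y. E (y - z))"
  by (auto simp: cylinder_def shift_def)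

lemma prob_cylinder_translate:
  assumes "finite J" "\<forall>x\<in>J. E x \<in> sets borel"
  shows "prob (cylinder ((+) z ` J) (\<lambda>y. E (y - z))) = prob (cylinder J E)"
proof -
  have "prob (cylinder ((+) z ` J) (\<lambda>y. E (y - z)))
      = (\<Prod>y\<in>(+) z ` J. prob {\<omega>. \<omega> 0 \<in> E (y - z)})"
    using assms by (intro prob_cylinder) auto
  also have "\<dots> = (\<Prod>x\<in>J. prob {\<omega>. \<omega> 0 \<in> E x})"
    by (subst prod.reindex) (auto simp: inj_on_def)
  finally show ?thesis using prob_cylinder[OF assms] by simp
qed

text \<open>The probability of a cylinder depends only on the sets imposed on its coordinates, not on the
  sites where they are imposed; cylinders are a \<open>\<pi>\<close>-system generating the \<open>\<sigma>\<close>-algebra.\<close>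

lemma distr_shift: "distr P P (shift z) = P"
proof (rule measure_eqI_generator_eq[OF Int_stable_cylinders, where \<Omega> = UNIV and A = "\<lambda>_. UNIV"])
  let ?G = "{cylinder J E | J E. finite J \<and> (\<forall>x\<in>J. E x \<in> sets (borel :: real measure))}"
  show "sets (distr P P (shift z)) = sigma_sets UNIV ?G" "sets P = sigma_sets UNIV ?G"
    by (simp_all add: sets_P sigma_sets_cylinders)
  have "UNIV = cylinder {} (\<lambda>_. UNIV)" by (simp add: cylinder_def)
  then show "range (\<lambda>_::nat. UNIV) \<subseteq> ?G" by auto
  show "emeasure (distr P P (shift z)) UNIV \<noteq> \<infinity>"
    using sets.top[of P] by (subst emeasure_distr) auto
  fix X assume "X \<in> ?G"
  then obtain J E where X: "X = cylinder J E" "finite J" "\<forall>x\<in>J. E x \<in> sets borel" by auto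
  have "emeasure (distr P P (shift z)) X = emeasure P (shift z -` X)"
    using X cylinder_sets by (subst emeasure_distr) auto
  also have "\<dots> = emeasure P X"
    using prob_cylinder_translate[OF X(2,3)]
    by (simp add: X(1) shift_vimage_cylinder emeasure_eq_measure)
  finally show "emeasure (distr P P (shift z)) X = emeasure P X" .
qed auto

lemma integrable_shift:
  fixes f :: "env \<Rightarrow> real"
  assumes "integrable P f" shows "integrable P (\<lambda>\<omega>. f (shift z \<omega>))"
  using assms by (intro integrable_distr[of "shift z" P P f]) (auto simp: distr_shift)

lemma integral_shift:
  fixes f :: "env \<Rightarrow> real"
  assumes "f \<in> borel_measurable P" shows "(\<integral>\<omega>. f (shift z \<omega>) \<partial>P) = (\<integral>\<omega>. f \<omega> \<partial>P)"
  using integral_distr[of "shift z" P P f] assms by (simp add: distr_shift)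

lemma AE_shift:
  assumes "AE \<omega> in P. Q \<omega>" shows "AE \<omega> in P. Q (shift z \<omega>)"
  using AE_distrD[of "shift z" P P Q, unfolded distr_shift] assms by simp

lemma AE_all_shifts:
  assumes "AE \<omega> in P. Q \<omega>" shows "AE \<omega> in P. \<forall>z. Q (shift z \<omega>)"
  using AE_shift[OF assms] by (simp add: AE_all_countable)

end

section \<open>A mean ergodic theorem for i.i.d. environments\<close>

context iid_environment
begin

text \<open>Translates of a cylinder by distant multiples of \<open>z\<close> constrain disjoint sets of coordinates:
  a common coordinate would be \<open>k z + x = l z + y\<close> with \<open>x\<close>, \<open>y\<close> in the finite set \<open>J\<close>, which
  bounds \<open>\<bar>k - l\<bar>\<close> by the diameter of \<open>J\<close>.\<close>

lemma cylinders_decorrelate: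
  assumes "finite J" "\<forall>x\<in>J. E x \<in> sets borel" "z \<noteq> 0"
  shows "\<exists>R::nat. \<forall>k l. int R < \<bar>int k - int l\<bar> \<longrightarrow>
    prob (shift (multiple k z) -` cylinder J E \<inter> shift (multiple l z) -` cylinder J E)
      = prob (cylinder J E) ^ 2"
proof -
  have "finite ((\<lambda>(x, y). l1 (x - y)) ` (J \<times> J))" using assms by auto
  then have "l1 (x - y) \<le> Max ((\<lambda>(x, y). l1 (x - y)) ` (J \<times> J))" if "x \<in> J" "y \<in> J" for x y
    using that by (intro Max_ge) auto
  then obtain R0 where R0: "\<And>x y. x \<in> J \<Longrightarrow> y \<in> J \<Longrightarrow> l1 (x - y) \<le> R0" by blast
  have far: "shift (multiple k z) -` cylinder J E \<inter> shift (multiple l z) -` cylinder J E =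
      cylinder ((+) (multiple k z) ` J \<union> (+) (multiple l z) ` J)
        (\<lambda>y. if y \<in> (+) (multiple k z) ` J then E (y - multiple k z) else E (y - multiple l z))"
    and disj: "(+) (multiple k z) ` J \<inter> (+) (multiple l z) ` J = {}"
    if kl: "int (nat R0) < \<bar>int k - int l\<bar>" for k l
  proof -
    show *: "(+) (multiple k z) ` J \<inter> (+) (multiple l z) ` J = {}"
    proof (rule ccontr)
      assume "(+) (multiple k z) ` J \<inter> (+) (multiple l z) ` J \<noteq> {}"
      then obtain x y where xy: "x \<in> J" "y \<in> J" "multiple k z + x = multiple l z + y"
        unfolding image_def by blast
      then have "y - x = multiple k z - multiple l z" by (simp add: algebra_simps)
      then have "l1 (y - x) = \<bar>int k - int l\<bar> * l1 z"
        by (simp add: l1_def multiple_def left_diff_distrib[symmetric] abs_mult distrib_left)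
      moreover have "l1 z \<ge> 1"
        using assms(3) by (cases z) (auto simp: l1_def zero_prod_def)
      moreover have "\<bar>int k - int l\<bar> * 1 \<le> \<bar>int k - int l\<bar> * l1 z"
        using \<open>l1 z \<ge> 1\<close> by (intro mult_left_mono) auto
      ultimately have "\<bar>int k - int l\<bar> \<le> l1 (y - x)" by simp
      also have "\<dots> \<le> int (nat R0)" using R0[OF xy(2,1)] by simp
      finally show False using kl by simp
    qed
    show "shift (multiple k z) -` cylinder J E \<inter> shift (multiple l z) -` cylinder J E =
      cylinder ((+) (multiple k z) ` J \<union> (+) (multiple l z) ` J)
        (\<lambda>y. if y \<in> (+) (multiple k z) ` J then E (y - multiple k z) else E (y - multiple l z))"
      unfolding shift_vimage_cylinder by (rule cylinder_Int_disjoint[OF *])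
  qed
  have "prob (shift (multiple k z) -` cylinder J E \<inter> shift (multiple l z) -` cylinder J E)
      = prob (cylinder J E) ^ 2" if kl: "int (nat R0) < \<bar>int k - int l\<bar>" for k l
  proof -
    let ?J = "(+) (multiple k z) ` J" and ?J' = "(+) (multiple l z) ` J"
    let ?E = "\<lambda>y. E (y - multiple k z)" and ?E' = "\<lambda>y. E (y - multiple l z)"
    have borel: "E (y - a) \<in> sets borel" if "y \<in> (+) a ` J" for y a
      using that assms(2) by auto
    have borel_if: "\<forall>y\<in>?J \<union> ?J'. (if y \<in> ?J then ?E y else ?E' y) \<in> sets borel"
    proof
      fix y assume "y \<in> ?J \<union> ?J'"
      then show "(if y \<in> ?J then ?E y else ?E' y) \<in> sets borel"
        using borel by (cases "y \<in> ?J") (simp_all only: if_True if_False Un_iff simp_thms)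
    qed
    have "prob (cylinder (?J \<union> ?J') (\<lambda>y. if y \<in> ?J then ?E y else ?E' y))
        = (\<Prod>y\<in>?J \<union> ?J'. prob {\<omega>. \<omega> 0 \<in> (if y \<in> ?J then ?E y else ?E' y)})"
      using assms(1) by (intro prob_cylinder borel_if) auto
    also have "\<dots> = (\<Prod>y\<in>?J. prob {\<omega>. \<omega> 0 \<in> (if y \<in> ?J then ?E y else ?E' y)}) *
        (\<Prod>y\<in>?J'. prob {\<omega>. \<omega> 0 \<in> (if y \<in> ?J then ?E y else ?E' y)})"
      using assms(1) disj[OF kl] by (intro prod.union_disjoint) auto
    also have "(\<Prod>y\<in>?J. prob {\<omega>. \<omega> 0 \<in> (if y \<in> ?J then ?E y else ?E' y)})
        = prob (cylinder ?J ?E)"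
      using assms by (subst prob_cylinder) auto
    also have "(\<Prod>y\<in>?J'. prob {\<omega>. \<omega> 0 \<in> (if y \<in> ?J then ?E y else ?E' y)})
        = (\<Prod>y\<in>?J'. prob {\<omega>. \<omega> 0 \<in> ?E' y})"
      using disj[OF kl] by (intro prod.cong) auto
    also have "\<dots> = prob (cylinder ?J' ?E')"
      using assms by (subst prob_cylinder) auto
    finally show ?thesis
      unfolding far[OF kl] using prob_cylinder_translate[OF assms(1,2)]
      by (simp add: power2_eq_square)
  qed
  then show ?thesis by blast
qed

definition mean_ergodic :: "site \<Rightarrow> (env \<Rightarrow> real) \<Rightarrow> bool" where
  "mean_ergodic z f \<longleftrightarrow>
    (\<lambda>n. \<integral>\<omega>. \<bar>(\<Sum>k<n. f (shift (multiple k z) \<omega>)) / real n - expectation f\<bar> \<partial>P) \<longlonglongrightarrow> 0"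

lemma integrable_average:
  fixes f :: "env \<Rightarrow> real"
  assumes "integrable P f"
  shows "integrable P (\<lambda>\<omega>. (\<Sum>k<n. f (shift (multiple k z) \<omega>)) / real n)"
  using assms by (intro integrable_divide Bochner_Integration.integrable_sum integrable_shift)

text \<open>In the second moment of the centred average only the \<open>O(n)\<close> pairs \<open>(k, l)\<close> with
  \<open>\<bar>k - l\<bar> \<le> R\<close> contribute, out of a normalisation \<open>n\<^sup>2\<close>; the first absolute moment is bounded by
  the root of the second.\<close>

lemma mean_ergodic_cylinder:
  assumes "finite J" "\<forall>x\<in>J. E x \<in> sets borel" "z \<noteq> 0"
  shows "mean_ergodic z (indicator (cylinder J E))"
proof -
  let ?A = "cylinder J E"
  let ?p = "prob ?A"
  obtain R where R: "\<And>k l. int R < \<bar>int k - int l\<bar> \<Longrightarrow>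
    prob (shift (multiple k z) -` ?A \<inter> shift (multiple l z) -` ?A) = ?p ^ 2"
    using cylinders_decorrelate[OF assms] by blast
  have A [measurable]: "?A \<in> sets P" using cylinder_sets[OF assms(1,2)] .
  have Ak: "shift y -` ?A \<in> sets P" for y
    using measurable_sets[OF measurable_shift A] by simp
  define Z where "Z k \<omega> = indicator (shift (multiple k z) -` ?A) \<omega> - ?p" for k \<omega>
  have Z_meas [measurable]: "Z k \<in> borel_measurable P" for k
    unfolding Z_def using Ak by measurable
  have Z_bound: "\<bar>Z k \<omega>\<bar> \<le> 1" for k \<omega>
    unfolding Z_def using prob_le_1[of ?A] measure_nonneg[of P ?A] by (auto simp: indicator_def)
  have ZZ_bound: "\<bar>Z k \<omega> * Z l \<omega>\<bar> \<le> 1" for k l \<omega>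
    using mult_mono[OF Z_bound[of k \<omega>] Z_bound[of l \<omega>]] by (simp add: abs_mult)
  have ZZ_int: "integrable P (\<lambda>\<omega>. Z k \<omega> * Z l \<omega>)" for k l
    by (rule integrable_const_bound[where B = 1]) (use ZZ_bound in auto)
  have prob_Ak: "prob (shift y -` ?A) = ?p" for y
    using prob_cylinder_translate[OF assms(1,2)] by (simp add: shift_vimage_cylinder)
  have ZZ: "expectation (\<lambda>\<omega>. Z k \<omega> * Z l \<omega>) \<le> (if int R < \<bar>int k - int l\<bar> then 0 else 1)" for k l
  proof (cases "int R < \<bar>int k - int l\<bar>")
    case True
    let ?Ak = "shift (multiple k z) -` ?A" and ?Al = "shift (multiple l z) -` ?A"
    have "expectation (\<lambda>\<omega>. Z k \<omega> * Z l \<omega>) = expectation (\<lambda>\<omega>. indicator (?Ak \<inter> ?Al) \<omega>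
        - ?p * indicator ?Ak \<omega> - ?p * indicator ?Al \<omega> + ?p ^ 2)"
      by (intro Bochner_Integration.integral_cong)
        (auto simp: Z_def indicator_def power2_eq_square algebra_simps)
    also have "\<dots> = prob (?Ak \<inter> ?Al) - ?p * prob ?Ak - ?p * prob ?Al + ?p ^ 2"
      using Ak prob_space by (simp add: emeasure_eq_measure)
    also have "\<dots> = 0"
      using R[OF True] by (simp add: prob_Ak power2_eq_square)
    finally show ?thesis using True by simp
  next
    case False
    have "expectation (\<lambda>\<omega>. Z k \<omega> * Z l \<omega>) \<le> expectation (\<lambda>_. 1)"
      using ZZ_bound by (intro integral_mono ZZ_int) (auto simp: abs_le_iff)
    then show ?thesis using False prob_space by simp
  qed
  define D where "D n \<omega> = (\<Sum>k<n. Z k \<omega>) / real n" for n \<omega>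
  have D2_eq: "D n \<omega> ^ 2 = (\<Sum>k<n. \<Sum>l<n. Z k \<omega> * Z l \<omega>) / real n ^ 2" for n \<omega>
    by (simp add: D_def power2_eq_square sum_product)
  have D2_int: "integrable P (\<lambda>\<omega>. D n \<omega> ^ 2)" for n
    unfolding D2_eq by (intro integrable_divide Bochner_Integration.integrable_sum ZZ_int)
  have D_int: "integrable P (\<lambda>\<omega>. \<bar>D n \<omega>\<bar>)" for n
    unfolding D_def Z_def using Ak
    by (intro integrable_abs integrable_divide Bochner_Integration.integrable_sum
        Bochner_Integration.integrable_diff)
      (auto simp: emeasure_eq_measure)
  have D2: "expectation (\<lambda>\<omega>. D n \<omega> ^ 2) \<le> real (2 * R + 1) / real n" for n
  proof -
    have row: "(\<Sum>l<n. expectation (\<lambda>\<omega>. Z k \<omega> * Z l \<omega>)) \<le> real (2 * R + 1)" for k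
    proof -
      have "(\<Sum>l<n. expectation (\<lambda>\<omega>. Z k \<omega> * Z l \<omega>))
          \<le> (\<Sum>l<n. if l \<in> {k - R..k + R} then 1 else 0)"
        using ZZ[of k] by (intro sum_mono) (smt (verit) atLeastAtMost_iff of_nat_add of_nat_le_iff le_diff_conv)
      also have "\<dots> = real (card ({..<n} \<inter> {k - R..k + R}))"
        by (simp add: sum.If_cases Int_def)
      also have "\<dots> \<le> real (card {k - R..k + R})"
        by (intro of_nat_mono card_mono) auto
      also have "\<dots> \<le> real (2 * R + 1)" by simp
      finally show ?thesis .
    qed
    have "expectation (\<lambda>\<omega>. D n \<omega> ^ 2)
        = (\<Sum>k<n. \<Sum>l<n. expectation (\<lambda>\<omega>. Z k \<omega> * Z l \<omega>)) / real n ^ 2"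
      unfolding D2_eq by (simp add: ZZ_int)
    also have "\<dots> \<le> (\<Sum>k<n. real (2 * R + 1)) / real n ^ 2"
      by (intro divide_right_mono sum_mono row) auto
    also have "\<dots> = real (2 * R + 1) / real n"
      by (simp add: power2_eq_square)
    finally show ?thesis .
  qed
  have L1: "expectation (\<lambda>\<omega>. \<bar>D n \<omega>\<bar>) \<le> sqrt (real (2 * R + 1) / real n)" for n
  proof -
    have "0 \<le> variance (\<lambda>\<omega>. \<bar>D n \<omega>\<bar>)" by (rule variance_positive)
    also have "\<dots> = expectation (\<lambda>\<omega>. D n \<omega> ^ 2) - (expectation (\<lambda>\<omega>. \<bar>D n \<omega>\<bar>)) ^ 2"
      using D_int D2_int by (subst variance_eq) auto
    finally show ?thesis using D2[of n] by (intro real_le_rsqrt) linarith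
  qed
  have "(\<lambda>n. sqrt (real (2 * R + 1) / real n)) \<longlonglongrightarrow> sqrt 0"
    by (intro tendsto_real_sqrt lim_const_over_n)
  then have "(\<lambda>n. expectation (\<lambda>\<omega>. \<bar>D n \<omega>\<bar>)) \<longlonglongrightarrow> 0"
    unfolding real_sqrt_zero by (intro tendsto_zero_dominated[OF _ L1]) auto
  moreover have "\<forall>\<^sub>F n in sequentially. expectation (\<lambda>\<omega>. \<bar>D n \<omega>\<bar>) =
    expectation (\<lambda>\<omega>. \<bar>(\<Sum>k<n. indicator ?A (shift (multiple k z) \<omega>)) / real n
      - expectation (indicator ?A)\<bar>)"
    using eventually_gt_at_top[of 0]
  proof eventually_elim
    case (elim n)
    have "D n \<omega> = (\<Sum>k<n. indicator ?A (shift (multiple k z) \<omega>)) / real n - expectation (indicator ?A)" for \<omega>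
      using elim A by (simp add: D_def Z_def sum_subtractf diff_divide_distrib indicator_vimage)
    then show ?case by simp
  qed
  ultimately show ?thesis
    unfolding mean_ergodic_def by (rule Lim_transform_eventually)
qed

lemma mean_ergodic_add:
  assumes f: "integrable P f" "mean_ergodic z f" and g: "integrable P g" "mean_ergodic z g"
  shows "mean_ergodic z (\<lambda>\<omega>. f \<omega> + g \<omega>)"
proof -
  let ?D = "\<lambda>f n \<omega>. (\<Sum>k<n. f (shift (multiple k z) \<omega>)) / real n - expectation f"
  have int: "integrable P (\<lambda>\<omega>. \<bar>?D f n \<omega>\<bar>)" if "integrable P f" for f n
    using integrable_average[OF that] by simp
  have lim: "(\<lambda>n. expectation (\<lambda>\<omega>. \<bar>?D f n \<omega>\<bar>) + expectation (\<lambda>\<omega>. \<bar>?D g n \<omega>\<bar>)) \<longlonglongrightarrow> 0 + 0"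
    using f(2) g(2) unfolding mean_ergodic_def by (rule tendsto_add)
  have bound: "expectation (\<lambda>\<omega>. \<bar>?D (\<lambda>\<omega>. f \<omega> + g \<omega>) n \<omega>\<bar>)
      \<le> expectation (\<lambda>\<omega>. \<bar>?D f n \<omega>\<bar>) + expectation (\<lambda>\<omega>. \<bar>?D g n \<omega>\<bar>)" for n
  proof -
    have "?D (\<lambda>\<omega>. f \<omega> + g \<omega>) n \<omega> = ?D f n \<omega> + ?D g n \<omega>" for \<omega>
      using f(1) g(1) by (simp add: sum.distrib add_divide_distrib)
    then have "expectation (\<lambda>\<omega>. \<bar>?D (\<lambda>\<omega>. f \<omega> + g \<omega>) n \<omega>\<bar>)
        \<le> expectation (\<lambda>\<omega>. \<bar>?D f n \<omega>\<bar> + \<bar>?D g n \<omega>\<bar>)"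
      using int[of "\<lambda>\<omega>. f \<omega> + g \<omega>"] f(1) g(1)
      by (intro integral_mono Bochner_Integration.integrable_add int) auto
    then show ?thesis
      using int[OF f(1), of n] int[OF g(1), of n] by (simp only: Bochner_Integration.integral_add)
  qed
  have nonneg: "0 \<le> expectation (\<lambda>\<omega>. \<bar>?D (\<lambda>\<omega>. f \<omega> + g \<omega>) n \<omega>\<bar>)" for n
    by (rule Bochner_Integration.integral_nonneg) simp
  show ?thesis
    unfolding mean_ergodic_def by (rule tendsto_zero_dominated[OF nonneg bound lim[unfolded add_0]])
qed

lemma mean_ergodic_scale:
  assumes "mean_ergodic z f"
  shows "mean_ergodic z (\<lambda>\<omega>. c * f \<omega>)"
proof -
  have "(\<lambda>n. \<bar>c\<bar> * expectation (\<lambda>\<omega>. \<bar>(\<Sum>k<n. f (shift (multiple k z) \<omega>)) / real n - expectation f\<bar>))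
      \<longlonglongrightarrow> \<bar>c\<bar> * 0"
    using assms unfolding mean_ergodic_def by (intro tendsto_mult_left)
  moreover have "expectation (\<lambda>\<omega>. \<bar>(\<Sum>k<n. c * f (shift (multiple k z) \<omega>)) / real n - expectation (\<lambda>\<omega>. c * f \<omega>)\<bar>)
      = \<bar>c\<bar> * expectation (\<lambda>\<omega>. \<bar>(\<Sum>k<n. f (shift (multiple k z) \<omega>)) / real n - expectation f\<bar>)" for n
  proof -
    have "\<bar>(\<Sum>k<n. c * f (shift (multiple k z) \<omega>)) / real n - expectation (\<lambda>\<omega>. c * f \<omega>)\<bar>
      = \<bar>c\<bar> * \<bar>(\<Sum>k<n. f (shift (multiple k z) \<omega>)) / real n - expectation f\<bar>" for \<omega>
      by (simp add: sum_distrib_left[symmetric] abs_mult[symmetric] right_diff_distrib)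
    then show ?thesis by simp
  qed
  ultimately show ?thesis unfolding mean_ergodic_def by simp
qed

text \<open>Averages of shifted functions are contractions of \<open>L\<^sup>1\<close> because the shift preserves the
  measure. Hence the ergodic property passes to limits, the error being controlled uniformly in
  \<open>n\<close>.\<close>

lemma mean_ergodic_L1_closed:
  assumes f: "integrable P f"
    and approx: "\<And>\<epsilon>. 0 < \<epsilon> \<Longrightarrow>
      \<exists>g. integrable P g \<and> mean_ergodic z g \<and> expectation (\<lambda>\<omega>. \<bar>f \<omega> - g \<omega>\<bar>) \<le> \<epsilon>"
  shows "mean_ergodic z f"
proof -
  let ?A = "\<lambda>f n \<omega>. (\<Sum>k<n. f (shift (multiple k z) \<omega>)) / real n"
  have "\<forall>\<^sub>F n in sequentially. \<bar>expectation (\<lambda>\<omega>. \<bar>?A f n \<omega> - expectation f\<bar>)\<bar> < \<epsilon>" if "0 < \<epsilon>" for \<epsilon>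
  proof -
    from approx[of "\<epsilon> / 3"] that obtain g where g: "integrable P g" "mean_ergodic z g"
      and fg: "expectation (\<lambda>\<omega>. \<bar>f \<omega> - g \<omega>\<bar>) \<le> \<epsilon> / 3" by auto
    have fg_int: "integrable P (\<lambda>\<omega>. \<bar>f \<omega> - g \<omega>\<bar>)" using f g by auto
    have "\<forall>\<^sub>F n in sequentially. expectation (\<lambda>\<omega>. \<bar>?A g n \<omega> - expectation g\<bar>) < \<epsilon> / 3"
      using g(2) that unfolding mean_ergodic_def by (intro order_tendstoD(2)[of _ 0]) auto
    then show ?thesis
      using eventually_gt_at_top[of 0]
    proof eventually_elim
      case (elim n)
      let ?d = "\<lambda>\<omega>. (\<Sum>k<n. \<bar>f (shift (multiple k z) \<omega>) - g (shift (multiple k z) \<omega>)\<bar>) / real n"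
      let ?c = "\<bar>expectation g - expectation f\<bar>"
      have d_int: "integrable P ?d"
        using integrable_average[OF fg_int, of z n] by simp
      have "expectation ?d = (\<Sum>k<n. expectation (\<lambda>\<omega>. \<bar>f (shift (multiple k z) \<omega>) - g (shift (multiple k z) \<omega>)\<bar>)) / real n"
        using integrable_shift[OF fg_int] by simp
      also have "\<dots> = expectation (\<lambda>\<omega>. \<bar>f \<omega> - g \<omega>\<bar>)"
        using elim integral_shift[of "\<lambda>\<omega>. \<bar>f \<omega> - g \<omega>\<bar>"] fg_int by simp
      finally have d: "expectation ?d \<le> \<epsilon> / 3" using fg by simp
      have "?c = \<bar>expectation (\<lambda>\<omega>. f \<omega> - g \<omega>)\<bar>" using f g by simp
      also have "\<dots> \<le> expectation (\<lambda>\<omega>. \<bar>f \<omega> - g \<omega>\<bar>)" by (rule integral_abs_bound)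
      finally have c: "?c \<le> \<epsilon> / 3" using fg by simp
      have int: "integrable P (\<lambda>\<omega>. \<bar>?A f n \<omega> - expectation f\<bar>)" "integrable P (\<lambda>\<omega>. \<bar>?A g n \<omega> - expectation g\<bar>)"
        using integrable_average[OF f, of z n] integrable_average[OF g(1), of z n] by simp_all
      have "expectation (\<lambda>\<omega>. \<bar>?A f n \<omega> - expectation f\<bar>)
          \<le> expectation (\<lambda>\<omega>. ?d \<omega> + \<bar>?A g n \<omega> - expectation g\<bar> + ?c)"
      proof (rule integral_mono[OF int(1)])
        show "integrable P (\<lambda>\<omega>. ?d \<omega> + \<bar>?A g n \<omega> - expectation g\<bar> + ?c)"
          by (intro Bochner_Integration.integrable_add d_int int(2)) simp
        fix \<omega>
        have "\<bar>(\<Sum>k<n. f (shift (multiple k z) \<omega>)) - (\<Sum>k<n. g (shift (multiple k z) \<omega>))\<bar>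
            \<le> (\<Sum>k<n. \<bar>f (shift (multiple k z) \<omega>) - g (shift (multiple k z) \<omega>)\<bar>)"
          unfolding sum_subtractf[symmetric] by (rule sum_abs)
        then have "\<bar>?A f n \<omega> - ?A g n \<omega>\<bar> \<le> ?d \<omega>"
          unfolding diff_divide_distrib[symmetric] abs_divide by (simp add: divide_right_mono)
        then show "\<bar>?A f n \<omega> - expectation f\<bar> \<le> ?d \<omega> + \<bar>?A g n \<omega> - expectation g\<bar> + ?c"
          by linarith
      qed
      also have "\<dots> = expectation ?d + expectation (\<lambda>\<omega>. \<bar>?A g n \<omega> - expectation g\<bar>) + ?c"
        using d_int int(2) prob_space by simp
      also have "\<dots> < \<epsilon>" using d c elim(1) by linarith
      finally show ?case by simp
    qed
  qed
  then show ?thesis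
    unfolding mean_ergodic_def tendsto_iff dist_real_def by simp
qed

lemma mean_ergodic_const: "mean_ergodic z (\<lambda>_. c)"
proof -
  have "\<forall>\<^sub>F n in sequentially. 0 = expectation (\<lambda>\<omega>. \<bar>(\<Sum>k<n. c) / real n - expectation (\<lambda>_. c)\<bar>)"
    using eventually_gt_at_top[of 0] by eventually_elim (simp add: prob_space)
  then show ?thesis
    unfolding mean_ergodic_def by (rule Lim_transform_eventually[OF tendsto_const])
qed

lemma mean_ergodic_sum:
  fixes f :: "nat \<Rightarrow> env \<Rightarrow> real"
  assumes "\<And>i. integrable P (f i)" "\<And>i. mean_ergodic z (f i)"
  shows "mean_ergodic z (\<lambda>\<omega>. \<Sum>i<m. f i \<omega>)"
proof (induction m)
  case 0
  show ?case using mean_ergodic_const[of z 0] by simp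
next
  case (Suc m)
  then show ?case
    using mean_ergodic_add[of "\<lambda>\<omega>. \<Sum>i<m. f i \<omega>" z "f m"] assms by simp
qed

text \<open>The events with the ergodic property form a Dynkin system: a countable disjoint union is
  approximated in \<open>L\<^sup>1\<close> by its finite partial unions.\<close>

lemma mean_ergodic_indicator:
  assumes "A \<in> sets P" "z \<noteq> 0"
  shows "mean_ergodic z (indicator A)"
proof -
  let ?G = "{cylinder J E | J E. finite J \<and> (\<forall>x\<in>J. E x \<in> sets borel)}"
  have G: "?G \<subseteq> Pow UNIV" by simp
  have "A \<in> sigma_sets UNIV ?G"
    using assms(1) unfolding sets_P sigma_sets_cylinders .
  with Int_stable_cylinders G show ?thesis
  proof (induction rule: sigma_sets_induct_disjoint)
    case (basic A)
    then show ?case using mean_ergodic_cylinder[OF _ _ assms(2)] by auto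
  next
    case empty
    have "(indicator {} :: env \<Rightarrow> real) = (\<lambda>_. 0)" by auto
    then show ?case using mean_ergodic_const[of z 0] by simp
  next
    case (compl A)
    have A: "A \<in> sets P" using compl(1) unfolding sets_P sigma_sets_cylinders .
    have eq: "(indicator (UNIV - A) :: env \<Rightarrow> real) = (\<lambda>\<omega>. 1 + (-1) * indicator A \<omega>)"
      by (auto simp: indicator_def)
    show ?case
      unfolding eq using A compl(2)
      by (intro mean_ergodic_add mean_ergodic_const mean_ergodic_scale)
        (auto simp: emeasure_eq_measure)
  next
    case (union A)
    have A: "\<And>i. A i \<in> sets P" using union(2) unfolding sets_P sigma_sets_cylinders by auto
    have int: "integrable P (indicat_real (A i))" for i
      using A by (auto simp: emeasure_eq_measure)
    have UA: "(\<Union>i. A i) \<in> sets P" using A by auto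
    have intU: "integrable P (indicat_real (\<Union>i. A i))"
      using UA by (auto simp: emeasure_eq_measure)
    show ?case
    proof (rule mean_ergodic_L1_closed[OF intU])
      fix \<epsilon> :: real assume "0 < \<epsilon>"
      have "(\<lambda>i. prob (A i)) sums prob (\<Union>i. A i)"
        using finite_measure_UNION[OF _ union(1)] A by auto
      then have "(\<lambda>m. prob (\<Union>i. A i) - (\<Sum>i<m. prob (A i))) \<longlonglongrightarrow> prob (\<Union>i. A i) - prob (\<Union>i. A i)"
        unfolding sums_def by (intro tendsto_diff tendsto_const)
      then have "\<forall>\<^sub>F m in sequentially. prob (\<Union>i. A i) - (\<Sum>i<m. prob (A i)) < \<epsilon>"
        using \<open>0 < \<epsilon>\<close> by (intro order_tendstoD(2)) auto
      then obtain m where m: "prob (\<Union>i. A i) - (\<Sum>i<m. prob (A i)) < \<epsilon>"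
        by (auto simp: eventually_sequentially)
      have sum_eq: "(\<Sum>i<m. indicat_real (A i) \<omega>) = indicator (\<Union>i<m. A i) \<omega>" for \<omega>
        using union(1) by (intro indicator_UN_disjoint[symmetric])
          (auto intro: disjoint_family_on_mono)
      have "\<bar>indicat_real (\<Union>i. A i) \<omega> - (\<Sum>i<m. indicat_real (A i) \<omega>)\<bar>
          = indicat_real (\<Union>i. A i) \<omega> - (\<Sum>i<m. indicat_real (A i) \<omega>)" for \<omega>
        unfolding sum_eq by (auto simp: indicator_def)
      then have "expectation (\<lambda>\<omega>. \<bar>indicat_real (\<Union>i. A i) \<omega> - (\<Sum>i<m. indicat_real (A i) \<omega>)\<bar>)
          = prob (\<Union>i. A i) - (\<Sum>i<m. prob (A i))"
        using int intU A UA by simp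
      then show "\<exists>g. integrable P g \<and> mean_ergodic z g \<and>
          expectation (\<lambda>\<omega>. \<bar>indicat_real (\<Union>i. A i) \<omega> - g \<omega>\<bar>) \<le> \<epsilon>"
        using m int mean_ergodic_sum[of "\<lambda>i. indicator (A i)" z m] union(3)
        by (intro exI[of _ "\<lambda>\<omega>. \<Sum>i<m. indicator (A i) \<omega>"]) simp
    qed
  qed
qed

lemma mean_ergodic_integrable:
  assumes "integrable P f" "z \<noteq> 0"
  shows "mean_ergodic z f"
  using assms(1)
proof (induction rule: integrable_induct)
  case (base A c)
  then show ?case
    using mean_ergodic_scale[OF mean_ergodic_indicator[OF base(1) assms(2)], of c]
    by (simp add: mult.commute)
next
  case (add f g)
  then show ?case by (intro mean_ergodic_add)
next
  case (lim f s)
  have s: "\<And>i. integrable P (s i)" "\<And>i. mean_ergodic z (s i)"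
    "\<And>\<omega>. \<omega> \<in> space P \<Longrightarrow> (\<lambda>i. s i \<omega>) \<longlonglongrightarrow> f \<omega>"
    "\<And>i \<omega>. \<omega> \<in> space P \<Longrightarrow> norm (s i \<omega>) \<le> 2 * norm (f \<omega>)"
    "integrable P f"
    using lim by auto
  have "(\<lambda>i. expectation (\<lambda>\<omega>. \<bar>f \<omega> - s i \<omega>\<bar>)) \<longlonglongrightarrow> expectation (\<lambda>_. 0)"
  proof (rule integral_dominated_convergence[where w = "\<lambda>\<omega>. 3 * \<bar>f \<omega>\<bar>"])
    show "AE \<omega> in P. (\<lambda>i. \<bar>f \<omega> - s i \<omega>\<bar>) \<longlonglongrightarrow> 0"
    proof (rule AE_I2)
      fix \<omega> assume "\<omega> \<in> space P"
      then have "(\<lambda>i. \<bar>f \<omega> - s i \<omega>\<bar>) \<longlonglongrightarrow> \<bar>f \<omega> - f \<omega>\<bar>"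
        by (intro tendsto_rabs tendsto_diff tendsto_const s(3))
      then show "(\<lambda>i. \<bar>f \<omega> - s i \<omega>\<bar>) \<longlonglongrightarrow> 0" by simp
    qed
    show "AE \<omega> in P. norm \<bar>f \<omega> - s i \<omega>\<bar> \<le> 3 * \<bar>f \<omega>\<bar>" for i
      using s(4)[of _ i] by (intro AE_I2) (smt (verit) real_norm_def)
  qed (use s(1,5) in auto)
  then have conv: "(\<lambda>i. expectation (\<lambda>\<omega>. \<bar>f \<omega> - s i \<omega>\<bar>)) \<longlonglongrightarrow> 0" by simp
  show ?case
  proof (rule mean_ergodic_L1_closed[OF s(5)])
    fix \<epsilon> :: real assume "0 < \<epsilon>"
    then have "\<forall>\<^sub>F i in sequentially. expectation (\<lambda>\<omega>. \<bar>f \<omega> - s i \<omega>\<bar>) < \<epsilon>"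
      using order_tendstoD(2)[OF conv] by simp
    then obtain i where "expectation (\<lambda>\<omega>. \<bar>f \<omega> - s i \<omega>\<bar>) < \<epsilon>"
      by (auto simp: eventually_sequentially)
    then show "\<exists>g. integrable P g \<and> mean_ergodic z g \<and> expectation (\<lambda>\<omega>. \<bar>f \<omega> - g \<omega>\<bar>) \<le> \<epsilon>"
      using s(1,2) by (intro exI[of _ "s i"]) simp
  qed
qed

end

section \<open>Means and growth of stationary cocycles\<close>

lemma cocycle_le_along_steps:
  fixes F :: "site \<Rightarrow> site \<Rightarrow> real"
  assumes coc: "\<And>x y z. F x y + F y z = F x z"
    and step: "\<And>x e. e \<in> {e1, e2} \<Longrightarrow> F x (x + e) \<le> c"
  shows "F x (x + (int m, int n)) \<le> c * (real m + real n)"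
proof (induction n)
  case 0
  show ?case
  proof (induction m)
    case 0
    show ?case using coc[of x x x] by (simp flip: zero_prod_def)
  next
    case (Suc m)
    have "x + (int m, 0) + e1 = x + (int (Suc m), 0)" by (cases x) (simp add: e1_def)
    then have "F (x + (int m, 0)) (x + (int (Suc m), 0)) \<le> c"
      using step[of e1 "x + (int m, 0)"] by (simp only: insertI1)
    then show ?case
      using Suc coc[of x "x + (int m, 0)" "x + (int (Suc m), 0)"] by (simp add: algebra_simps)
  qed
next
  case (Suc n)
  have "x + (int m, int n) + e2 = x + (int m, int (Suc n))" by (cases x) (simp add: e2_def)
  then have "F (x + (int m, int n)) (x + (int m, int (Suc n))) \<le> c"
    using step[of e2 "x + (int m, int n)"] by (simp only: insertI1 insertI2)
  then show ?case
    using Suc coc[of x "x + (int m, int n)" "x + (int m, int (Suc n))"] by (simp add: algebra_simps)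
qed

text \<open>The point \<open>x\<close> on the antidiagonal at distance \<open>K N\<close> lies below, and \<open>N\<close> steps away from, a
  point of the grid \<open>(j N, (K + 1 - j) N)\<close> on the next antidiagonal: round the first coordinate up
  strictly to a multiple of \<open>N\<close>. A cocycle with steps bounded above gains at most \<open>c N\<close> between
  the two.\<close>

lemma neg_cocycle_le_grid:
  fixes F :: "site \<Rightarrow> site \<Rightarrow> real"
  assumes coc: "\<And>x y z. F x y + F y z = F x z"
    and step: "\<And>x e. e \<in> {e1, e2} \<Longrightarrow> F x (x + e) \<le> c"
    and x: "0 \<le> fst x" "0 \<le> snd x" "fst x + snd x = int (K * N)" and "0 < N"
  shows "- F 0 x \<le> (\<Sum>j\<le>K + 1. \<bar>F 0 (int (j * N), int ((K + 1 - j) * N))\<bar>) + c * real N"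
proof -
  obtain a b where ab: "x = (int a, int b)" "a + b = K * N"
  proof
    show "x = (int (nat (fst x)), int (nat (snd x)))" using x by (simp add: prod_eq_iff)
    show "nat (fst x) + nat (snd x) = K * N" using x by linarith
  qed
  define j where "j = a div N + 1"
  have "a div N \<le> K" using ab(2) \<open>0 < N\<close> by (metis div_le_mono le_add1 nonzero_mult_div_cancel_right less_not_refl)
  then have jK: "j \<le> K + 1" by (simp add: j_def)
  define y where "y = (int (j * N), int ((K + 1 - j) * N))"
  have a_eq: "a = a div N * N + a mod N" by simp
  have s1: "j * N = a + (N - a mod N)"
  proof -
    have "j * N = a div N * N + N" by (simp add: j_def)
    then show ?thesis using mod_less_divisor[OF \<open>0 < N\<close>, of a] a_eq by linarith
  qed
  have "(K + 1 - j) * N = K * N - a div N * N" by (simp add: j_def diff_mult_distrib)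
  then have s2: "(K + 1 - j) * N = b + a mod N" using ab(2) a_eq by linarith
  have y: "y = x + (int (N - a mod N), int (a mod N))"
    unfolding y_def s1 s2 ab(1) by simp
  have "F x y \<le> c * (real (N - a mod N) + real (a mod N))"
    unfolding y by (rule cocycle_le_along_steps[OF coc step])
  also have "real (N - a mod N) + real (a mod N) = real N"
    using mod_less_divisor[OF \<open>0 < N\<close>, of a] by (simp add: of_nat_diff)
  finally have "F x y \<le> c * real N" .
  moreover have "\<bar>F 0 y\<bar> \<le> (\<Sum>j\<le>K + 1. \<bar>F 0 (int (j * N), int ((K + 1 - j) * N))\<bar>)"
    unfolding y_def using jK by (intro member_le_sum) auto
  ultimately show ?thesis using coc[of 0 x y] by linarith
qed

text \<open>The one-step bounds telescope along the path, by additivity of the cocycle.\<close>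

lemma path_weight_cocycle_le:
  fixes F :: "site \<Rightarrow> site \<Rightarrow> real"
  assumes coc: "\<And>x y z. F x y + F y z = F x z"
    and step: "\<And>x e. e \<in> {e1, e2} \<Longrightarrow> \<omega> x + h \<bullet> vec_of e + F x (x + e) \<le> C"
    and p: "up_right_path n p" "p 0 = 0"
  shows "(\<Sum>k<n. \<omega> (p k)) + h \<bullet> vec_of (p n) + F 0 (p n) \<le> real n * C"
  using p(1)
proof (induction n)
  case 0
  show ?case using coc[of 0 0 0] p(2) by (simp add: vec_of_def flip: zero_prod_def)
next
  case (Suc n)
  define e where "e = p (Suc n) - p n"
  have e: "e \<in> {e1, e2}" "p (Suc n) = p n + e" and "up_right_path n p"
    using Suc.prems by (auto simp: e_def up_right_path_Suc)
  have "vec_of (p (Suc n)) = vec_of (p n) + vec_of e"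
    by (simp add: e(2) vec_of_def)
  then have "h \<bullet> vec_of (p (Suc n)) = h \<bullet> vec_of (p n) + h \<bullet> vec_of e"
    by (simp add: inner_add_right)
  then show ?case
    using Suc.IH[OF \<open>up_right_path n p\<close>] step[OF e(1), of "p n"] coc[of 0 "p n" "p (Suc n)"]
    by (simp add: e(2) algebra_simps)
qed

context iid_environment
begin

lemma measurable_cocycle:
  assumes "F \<in> cocycles P" shows "(\<lambda>\<omega>. F \<omega> x y) \<in> borel_measurable P"
proof -
  have "(\<lambda>(\<omega>, x, y). F \<omega> x y) \<in> borel_measurable (P \<Otimes>\<^sub>M count_space UNIV \<Otimes>\<^sub>M count_space UNIV)"
    using assms by (simp add: cocycles_def)
  moreover have "(\<lambda>\<omega>. (\<omega>, x, y)) \<in> measurable P (P \<Otimes>\<^sub>M count_space UNIV \<Otimes>\<^sub>M count_space UNIV)"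
    by measurable
  ultimately have "(\<lambda>\<omega>. (\<lambda>(\<omega>, x, y). F \<omega> x y) (\<omega>, x, y)) \<in> borel_measurable P"
    by (rule measurable_compose[rotated])
  then show ?thesis by simp
qed

lemma cocycle_stationary:
  assumes "F \<in> cocycles P"
  shows "AE \<omega> in P. \<forall>x y z. F \<omega> (z + x) (z + y) = F (shift z \<omega>) x y"
  using assms by (simp add: cocycles_def)

lemma cocycle_additive:
  assumes "F \<in> cocycles P"
  shows "AE \<omega> in P. \<forall>x y z. F \<omega> x y + F \<omega> y z = F \<omega> x z"
  using assms by (simp add: cocycles_def)

lemma integrable_cocycle_axis:
  assumes "F \<in> cocycles P" "e \<in> {e1, e2}"
  shows "integrable P (\<lambda>\<omega>. F \<omega> 0 e)"
  using assms by (auto simp: cocycles_def)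

text \<open>By stationarity the mean of a cocycle over a unit step depends only on the direction of the
  step, so by additivity the mean is linear in the displacement.\<close>

lemma cocycle_mean:
  assumes F: "F \<in> cocycles P"
  shows "integrable P (\<lambda>\<omega>. F \<omega> x y)"
    and "expectation (\<lambda>\<omega>. F \<omega> x y) = - (hvec P F \<bullet> (vec_of y - vec_of x))"
proof -
  define good where "good x y \<longleftrightarrow> integrable P (\<lambda>\<omega>. F \<omega> x y) \<and>
    expectation (\<lambda>\<omega>. F \<omega> x y) = - (hvec P F \<bullet> (vec_of y - vec_of x))" for x y
  note [measurable] = measurable_cocycle[OF F]
  have cong: "integrable P f \<longleftrightarrow> integrable P g" "expectation f = expectation g"
    if "AE \<omega> in P. f \<omega> = g \<omega>" "f \<in> borel_measurable P" "g \<in> borel_measurable P" for f g :: "env \<Rightarrow> real"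
    using integrable_cong_AE[OF that(2,3,1)] integral_cong_AE[OF that(2,3,1)] by simp_all
  have trans: "good x z" if "good x y" "good y z" for x y z
  proof -
    have "AE \<omega> in P. F \<omega> x y + F \<omega> y z = F \<omega> x z"
      using cocycle_additive[OF F] by eventually_elim blast
    then have "integrable P (\<lambda>\<omega>. F \<omega> x y + F \<omega> y z) \<longleftrightarrow> integrable P (\<lambda>\<omega>. F \<omega> x z)"
      "expectation (\<lambda>\<omega>. F \<omega> x y + F \<omega> y z) = expectation (\<lambda>\<omega>. F \<omega> x z)"
      by (rule cong; measurable)+
    then show ?thesis using that by (auto simp: good_def inner_diff_right)
  qed
  have refl: "good x x" for x
  proof -
    have "AE \<omega> in P. F \<omega> x x = 0"
      using cocycle_additive[OF F]
    proof eventually_elim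
      case (elim \<omega>)
      then have "F \<omega> x x + F \<omega> x x = F \<omega> x x" by blast
      then show ?case by simp
    qed
    then have "integrable P (\<lambda>\<omega>. F \<omega> x x) \<longleftrightarrow> integrable P (\<lambda>\<omega>. 0::real)"
      "expectation (\<lambda>\<omega>. F \<omega> x x) = expectation (\<lambda>\<omega>. 0)"
      by (rule cong; measurable)+
    then show ?thesis by (simp add: good_def)
  qed
  have sym: "good y x" if "good x y" for x y
  proof -
    have "AE \<omega> in P. F \<omega> y x = - F \<omega> x y"
      using cocycle_additive[OF F]
    proof eventually_elim
      case (elim \<omega>)
      then have "F \<omega> x x + F \<omega> x x = F \<omega> x x" "F \<omega> x y + F \<omega> y x = F \<omega> x x" by blast+
      then show ?case by simp
    qed
    then have "integrable P (\<lambda>\<omega>. F \<omega> y x) \<longleftrightarrow> integrable P (\<lambda>\<omega>. - F \<omega> x y)"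
      "expectation (\<lambda>\<omega>. F \<omega> y x) = expectation (\<lambda>\<omega>. - F \<omega> x y)"
      by (rule cong; measurable)+
    then show ?thesis using that by (simp add: good_def inner_diff_right)
  qed
  have step: "good x (x + e)" if e: "e \<in> {e1, e2}" for x e
  proof -
    have ae: "AE \<omega> in P. F \<omega> x (x + e) = F (shift x \<omega>) 0 e"
      using cocycle_stationary[OF F]
    proof eventually_elim
      case (elim \<omega>)
      then have "F \<omega> (x + 0) (x + e) = F (shift x \<omega>) 0 e" by blast
      then show ?case by simp
    qed
    have meas: "(\<lambda>\<omega>. F (shift x \<omega>) 0 e) \<in> borel_measurable P"
      by (rule measurable_compose[OF measurable_shift measurable_cocycle[OF F]])
    have "integrable P (\<lambda>\<omega>. F \<omega> x (x + e)) \<longleftrightarrow> integrable P (\<lambda>\<omega>. F (shift x \<omega>) 0 e)"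
      "expectation (\<lambda>\<omega>. F \<omega> x (x + e)) = expectation (\<lambda>\<omega>. F (shift x \<omega>) 0 e)"
      by (rule cong[OF ae measurable_cocycle[OF F] meas])+
    moreover have "integrable P (\<lambda>\<omega>. F (shift x \<omega>) 0 e)"
      by (rule integrable_shift[OF integrable_cocycle_axis[OF F e]])
    moreover have "expectation (\<lambda>\<omega>. F (shift x \<omega>) 0 e) = expectation (\<lambda>\<omega>. F \<omega> 0 e)"
      by (rule integral_shift) measurable
    moreover have "expectation (\<lambda>\<omega>. F \<omega> 0 e) = - (hvec P F \<bullet> (vec_of (x + e) - vec_of x))"
      using e by (auto simp: hvec_def vec_of_def e1_def e2_def)
    ultimately show ?thesis by (simp add: good_def)
  qed
  have row: "good (0, b) (m, b)" for m b
  proof (induction m rule: int_induct[of _ 0])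
    case base
    show ?case by (rule refl)
  next
    case (step1 i)
    have "good (i, b) (i + 1, b)" using step[of e1 "(i, b)"] by (simp add: e1_def)
    with step1(2) show ?case by (rule trans)
  next
    case (step2 i)
    have "good (i - 1, b) (i, b)" using step[of e1 "(i - 1, b)"] by (simp add: e1_def)
    from step2(2) sym[OF this] show ?case by (rule trans)
  qed
  have column: "good (0, 0) (0, n)" for n
  proof (induction n rule: int_induct[of _ 0])
    case base
    show ?case by (rule refl)
  next
    case (step1 i)
    have "good (0, i) (0, i + 1)" using step[of e2 "(0, i)"] by (simp add: e2_def)
    with step1(2) show ?case by (rule trans)
  next
    case (step2 i)
    have "good (0, i - 1) (0, i)" using step[of e2 "(0, i - 1)"] by (simp add: e2_def)
    from step2(2) sym[OF this] show ?case by (rule trans)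
  qed
  have origin: "good (0, 0) z" for z using trans[OF column row, of "fst z" "snd z"] by simp
  have "good x y" by (rule trans[OF sym[OF origin] origin])
  then show "integrable P (\<lambda>\<omega>. F \<omega> x y)"
    "expectation (\<lambda>\<omega>. F \<omega> x y) = - (hvec P F \<bullet> (vec_of y - vec_of x))"
    by (auto simp: good_def)
qed

text \<open>Along one axis a cocycle is the sum of its shifted first steps, to which the ergodic theorem
  applies.\<close>

lemma cocycle_axis_sublinear:
  assumes F: "F \<in> cocycles P" and e: "e \<in> {e1, e2}" and mean: "expectation (\<lambda>\<omega>. F \<omega> 0 e) = 0"
  shows "(\<lambda>n. expectation (\<lambda>\<omega>. \<bar>F \<omega> 0 (multiple n e)\<bar>) / real n) \<longlonglongrightarrow> 0"
proof -
  note [measurable] = measurable_cocycle[OF F]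
  have ae: "AE \<omega> in P. F \<omega> 0 (multiple n e) = (\<Sum>k<n. F (shift (multiple k e) \<omega>) 0 e)" for n
    using cocycle_stationary[OF F] cocycle_additive[OF F]
  proof eventually_elim
    case (elim \<omega>)
    show ?case
    proof (induction n)
      case 0
      have "F \<omega> 0 0 + F \<omega> 0 0 = F \<omega> 0 0" using elim(2) by blast
      then show ?case by (simp add: multiple_def flip: zero_prod_def)
    next
      case (Suc n)
      have "multiple (Suc n) e = multiple n e + e"
        by (cases e) (simp add: multiple_def algebra_simps)
      moreover have "F \<omega> (multiple n e + 0) (multiple n e + e) = F (shift (multiple n e) \<omega>) 0 e"
        using elim(1) by blast
      moreover have "F \<omega> 0 (multiple n e) + F \<omega> (multiple n e) (multiple (Suc n) e)
          = F \<omega> 0 (multiple (Suc n) e)" using elim(2) by blast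
      ultimately show ?case using Suc by simp
    qed
  qed
  have "e \<noteq> 0" using e by (auto simp: e1_def e2_def zero_prod_def)
  then have "mean_ergodic e (\<lambda>\<omega>. F \<omega> 0 e)"
    using mean_ergodic_integrable integrable_cocycle_axis[OF F e] by blast
  moreover have "expectation (\<lambda>\<omega>. \<bar>(\<Sum>k<n. F (shift (multiple k e) \<omega>) 0 e) / real n - expectation (\<lambda>\<omega>. F \<omega> 0 e)\<bar>)
      = expectation (\<lambda>\<omega>. \<bar>F \<omega> 0 (multiple n e)\<bar>) / real n" for n
  proof -
    have "expectation (\<lambda>\<omega>. \<bar>(\<Sum>k<n. F (shift (multiple k e) \<omega>) 0 e) / real n - expectation (\<lambda>\<omega>. F \<omega> 0 e)\<bar>)
        = expectation (\<lambda>\<omega>. \<bar>\<Sum>k<n. F (shift (multiple k e) \<omega>) 0 e\<bar> / real n)"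
      by (simp add: mean)
    also have "\<dots> = expectation (\<lambda>\<omega>. \<bar>\<Sum>k<n. F (shift (multiple k e) \<omega>) 0 e\<bar>) / real n"
      by simp
    also have "expectation (\<lambda>\<omega>. \<bar>\<Sum>k<n. F (shift (multiple k e) \<omega>) 0 e\<bar>)
        = expectation (\<lambda>\<omega>. \<bar>F \<omega> 0 (multiple n e)\<bar>)"
    proof (rule integral_cong_AE)
      show "(\<lambda>\<omega>. \<bar>\<Sum>k<n. F (shift (multiple k e) \<omega>) 0 e\<bar>) \<in> borel_measurable P"
        using measurable_compose[OF measurable_shift measurable_cocycle[OF F]]
        by (intro borel_measurable_abs borel_measurable_sum) auto
      show "AE \<omega> in P. \<bar>\<Sum>k<n. F (shift (multiple k e) \<omega>) 0 e\<bar> = \<bar>F \<omega> 0 (multiple n e)\<bar>"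
        using ae[of n] by eventually_elim simp
    qed measurable
    finally show ?thesis .
  qed
  ultimately show ?thesis by (simp add: mean_ergodic_def)
qed

text \<open>Reaching \<open>(m, n)\<close> through \<open>(m, 0)\<close> and using stationarity for the second leg reduces an
  arbitrary direction to the two axes.\<close>

lemma cocycle_sublinear:
  assumes F: "F \<in> cocycles0 P"
  shows "(\<lambda>N. expectation (\<lambda>\<omega>. \<bar>F \<omega> 0 (int (a * N), int (b * N))\<bar>) / real N) \<longlonglongrightarrow> 0"
proof -
  have FK: "F \<in> cocycles P" and mean: "\<And>x y. expectation (\<lambda>\<omega>. F \<omega> x y) = 0"
    using F by (auto simp: cocycles0_def)
  note [measurable] = measurable_cocycle[OF FK]
  have int: "integrable P (\<lambda>\<omega>. \<bar>F \<omega> x y\<bar>)" for x y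
    using cocycle_mean(1)[OF FK] by simp
  let ?m = "\<lambda>x. expectation (\<lambda>\<omega>. \<bar>F \<omega> 0 x\<bar>)"
  have axis: "(\<lambda>N. ?m (multiple (k * N) e) / real N) \<longlonglongrightarrow> 0" if e: "e \<in> {e1, e2}" for k e
  proof (cases "k = 0")
    case True
    have "?m (multiple (k * 0) e) = 0"
    proof -
      have "AE \<omega> in P. \<bar>F \<omega> 0 0\<bar> = 0"
        using cocycle_additive[OF FK]
      proof eventually_elim
        case (elim \<omega>)
        then have "F \<omega> 0 0 + F \<omega> 0 0 = F \<omega> 0 0" by blast
        then show ?case by simp
      qed
      then have "?m 0 = expectation (\<lambda>_. 0)" by (intro integral_cong_AE) auto
      then show ?thesis by (simp add: multiple_def flip: zero_prod_def)
    qed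
    then show ?thesis using True by simp
  next
    case False
    have "filterlim (\<lambda>N. k * N) sequentially sequentially"
      using False by (intro filterlim_subseq) (simp add: strict_mono_def)
    from filterlim_compose[OF cocycle_axis_sublinear[OF FK e mean] this]
    have "(\<lambda>N. real k * (?m (multiple (k * N) e) / real (k * N))) \<longlonglongrightarrow> real k * 0"
      by (intro tendsto_mult_left)
    moreover have "real k * (?m (multiple (k * N) e) / real (k * N)) = ?m (multiple (k * N) e) / real N" for N
      using False by (simp add: divide_simps)
    ultimately show ?thesis by simp
  qed
  have split: "?m (int m, int n) \<le> ?m (multiple m e1) + ?m (multiple n e2)" for m n
  proof -
    have "AE \<omega> in P. \<bar>F \<omega> 0 (int m, int n)\<bar>
        \<le> \<bar>F \<omega> 0 (multiple m e1)\<bar> + \<bar>F (shift (multiple m e1) \<omega>) 0 (multiple n e2)\<bar>"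
      using cocycle_additive[OF FK] cocycle_stationary[OF FK]
    proof eventually_elim
      case (elim \<omega>)
      have "multiple m e1 + multiple n e2 = (int m, int n)"
        by (simp add: multiple_def e1_def e2_def)
      moreover have "F \<omega> (multiple m e1 + 0) (multiple m e1 + multiple n e2)
          = F (shift (multiple m e1) \<omega>) 0 (multiple n e2)" using elim(2) by blast
      moreover have "F \<omega> 0 (multiple m e1) + F \<omega> (multiple m e1) (int m, int n) = F \<omega> 0 (int m, int n)"
        using elim(1) by blast
      ultimately show ?case by simp
    qed
    then have "?m (int m, int n) \<le> expectation (\<lambda>\<omega>. \<bar>F \<omega> 0 (multiple m e1)\<bar>
        + \<bar>F (shift (multiple m e1) \<omega>) 0 (multiple n e2)\<bar>)"
      by (intro integral_mono_AE Bochner_Integration.integrable_add int integrable_shift[OF int])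
    also have "\<dots> = ?m (multiple m e1)
        + expectation (\<lambda>\<omega>. \<bar>F (shift (multiple m e1) \<omega>) 0 (multiple n e2)\<bar>)"
      by (intro Bochner_Integration.integral_add int integrable_shift[OF int])
    also have "expectation (\<lambda>\<omega>. \<bar>F (shift (multiple m e1) \<omega>) 0 (multiple n e2)\<bar>) = ?m (multiple n e2)"
      by (rule integral_shift[of "\<lambda>\<omega>. \<bar>F \<omega> 0 (multiple n e2)\<bar>"]) measurable
    finally show ?thesis .
  qed
  have lim: "(\<lambda>N. ?m (multiple (a * N) e1) / real N + ?m (multiple (b * N) e2) / real N) \<longlonglongrightarrow> 0"
    using tendsto_add[OF axis[of e1 a] axis[of e2 b]] by simp
  have bound: "?m (int (a * N), int (b * N)) / real N
      \<le> ?m (multiple (a * N) e1) / real N + ?m (multiple (b * N) e2) / real N" for N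
    using divide_right_mono[OF split[of "a * N" "b * N"], of "real N"]
    by (simp only: add_divide_distrib of_nat_0_le_iff)
  have nonneg: "0 \<le> ?m (int (a * N), int (b * N)) / real N" for N
    by (intro divide_nonneg_nonneg Bochner_Integration.integral_nonneg) simp_all
  show ?thesis by (rule tendsto_zero_dominated[OF nonneg bound lim])
qed

end

section \<open>Limit shapes\<close>

context iid_environment
begin

lemma is_pl_limit_gpl:
  assumes "\<exists>r. is_pl_limit P h r" shows "is_pl_limit P h (gpl P h)"
proof -
  have "r = r'" if "is_pl_limit P h r" "is_pl_limit P h r'" for r r'
  proof -
    have "AE \<omega> in P. r = r'"
      using that unfolding is_pl_limit_def
      by eventually_elim (rule LIMSEQ_unique)
    then show ?thesis by simp
  qed
  then have "\<exists>!r. is_pl_limit P h r" using assms by blast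
  then show ?thesis unfolding gpl_def by (rule theI')
qed

lemma is_pp_limit_gpp:
  assumes "\<exists>r. is_pp_limit P \<zeta> r" shows "is_pp_limit P \<zeta> (gpp P \<zeta>)"
proof -
  have "r = r'" if "is_pp_limit P \<zeta> r" "is_pp_limit P \<zeta> r'" for r r'
  proof -
    have "AE \<omega> in P. r = r'"
      using that unfolding is_pp_limit_def
      by eventually_elim (rule LIMSEQ_unique)
    then show ?thesis by simp
  qed
  then have "\<exists>!r. is_pp_limit P \<zeta> r" using assms by blast
  then show ?thesis unfolding gpp_def by (rule theI')
qed

text \<open>The easy half of the variational formula for \<open>g\<^sub>p\<^sub>l\<close>. Convergence of the cocycle at the grid
  points holds in \<open>L\<^sup>1\<close>, hence almost surely along a subsequence; this suffices because the
  point-to-line passage times are known to converge along the whole sequence.\<close>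

lemma gpl_le_cocycle_bound:
  assumes F: "F \<in> cocycles0 P" and C: "AE \<omega> in P. pl_max h F \<omega> \<le> C"
    and lim: "is_pl_limit P h g"
  shows "g \<le> C"
proof -
  have FK: "F \<in> cocycles P" using F by (simp add: cocycles0_def)
  obtain b where b: "AE \<omega> in P. b \<le> \<omega> 0" using bounded_below by blast
  \<comment> \<open>Weights are at least \<open>b\<close>, so the bound \<open>C\<close> forces \<open>F(x, x + e) \<le> C - b - h \<bullet> e\<close>.\<close>
  define c where "c = max (C - b - h \<bullet> vec_of e1) (C - b - h \<bullet> vec_of e2)"
  have key: "AE \<omega> in P. (\<forall>x y z. F \<omega> x y + F \<omega> y z = F \<omega> x z) \<and>
      (\<forall>x. \<forall>e\<in>{e1, e2}. \<omega> x + h \<bullet> vec_of e + F \<omega> x (x + e) \<le> C \<and> F \<omega> x (x + e) \<le> c)"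
    using cocycle_additive[OF FK] cocycle_stationary[OF FK] AE_all_shifts[OF C] AE_all_shifts[OF b]
  proof eventually_elim
    case (elim \<omega>)
    have "\<omega> x + h \<bullet> vec_of e + F \<omega> x (x + e) \<le> C \<and> F \<omega> x (x + e) \<le> c" if e: "e \<in> {e1, e2}" for x e
    proof -
      have "F \<omega> (x + 0) (x + e) = F (shift x \<omega>) 0 e" using elim(2) by blast
      moreover have "shift x \<omega> 0 + h \<bullet> vec_of e + F (shift x \<omega>) 0 e \<le> C"
        using elim(3)[rule_format, of x] e unfolding pl_max_def by (subst (asm) Max_le_iff) auto
      moreover have "shift x \<omega> 0 = \<omega> x" by (simp add: shift_def)
      moreover have "b \<le> shift x \<omega> 0" using elim(4) by blast
      moreover have "C - b - h \<bullet> vec_of e \<le> c" using e unfolding c_def by auto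
      ultimately show ?thesis by simp
    qed
    then show ?case using elim(1) by blast
  qed
  have "g \<le> C + c / real K" if "0 < K" for K :: nat
  proof -
    let ?y = "\<lambda>N j. (int (j * N), int ((K + 1 - j) * N))"
    define u where "u N \<omega> = (\<Sum>j\<le>K + 1. \<bar>F \<omega> 0 (?y N j)\<bar>) / real N" for N \<omega>
    have int: "integrable P (\<lambda>\<omega>. \<bar>F \<omega> x y\<bar>)" for x y
      using cocycle_mean(1)[OF FK] by simp
    have u_int: "integrable P (u N)" for N
      unfolding u_def by (intro integrable_divide Bochner_Integration.integrable_sum int)
    have u_nonneg: "0 \<le> u N \<omega>" for N \<omega>
      unfolding u_def by (intro divide_nonneg_nonneg sum_nonneg) auto
    have "expectation (u N) = (\<Sum>j\<le>K + 1. expectation (\<lambda>\<omega>. \<bar>F \<omega> 0 (?y N j)\<bar>) / real N)" for N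
      unfolding u_def using int by (simp add: sum_divide_distrib add_divide_distrib)
    moreover have "(\<lambda>N. \<Sum>j\<le>K + 1. expectation (\<lambda>\<omega>. \<bar>F \<omega> 0 (?y N j)\<bar>) / real N) \<longlonglongrightarrow> (\<Sum>j\<le>K + 1. 0)"
      by (intro tendsto_sum cocycle_sublinear[OF F])
    ultimately have "(\<lambda>N. expectation (\<lambda>\<omega>. norm (u N \<omega>))) \<longlonglongrightarrow> 0"
      using u_nonneg by simp
    from tendsto_L1_AE_subseq[OF u_int this]
    obtain r where r: "strict_mono r" "AE \<omega> in P. (\<lambda>i. u (r i) \<omega>) \<longlonglongrightarrow> 0" by blast
    have "AE \<omega> in P. g \<le> C + c / real K"
      using key r(2) lim[unfolded is_pl_limit_def]
    proof eventually_elim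
      case (elim \<omega>)
      have coc: "\<And>x y z. F \<omega> x y + F \<omega> y z = F \<omega> x z"
        and wstep: "\<And>x e. e \<in> {e1, e2} \<Longrightarrow> \<omega> x + h \<bullet> vec_of e + F \<omega> x (x + e) \<le> C"
        and step: "\<And>x e. e \<in> {e1, e2} \<Longrightarrow> F \<omega> x (x + e) \<le> c"
        using elim(1) by blast+
      have bound: "last_passage_line \<omega> (K * N) h / real (K * N) \<le> C + u N \<omega> / real K + c / real K"
        if "0 < N" for N
      proof -
        have "last_passage_line \<omega> (K * N) h \<le> real (K * N) * C + (real N * u N \<omega> + c * real N)"
          unfolding last_passage_line_le_iff
        proof (intro allI impI, elim conjE)
          fix p assume p: "up_right_path (K * N) p" "p 0 = 0"
          have "(\<Sum>k<K * N. \<omega> (p k)) + h \<bullet> vec_of (p (K * N)) + F \<omega> 0 (p (K * N)) \<le> real (K * N) * C"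
            by (rule path_weight_cocycle_le[OF coc wstep p])
          moreover have "- F \<omega> 0 (p (K * N)) \<le> (\<Sum>j\<le>K + 1. \<bar>F \<omega> 0 (?y N j)\<bar>) + c * real N"
            using up_right_path_coords[OF p(1), of "K * N"] p(2) \<open>0 < N\<close>
            by (intro neg_cocycle_le_grid[OF coc step]) auto
          moreover have "(\<Sum>j\<le>K + 1. \<bar>F \<omega> 0 (?y N j)\<bar>) = real N * u N \<omega>"
            using \<open>0 < N\<close> by (simp add: u_def)
          ultimately show "(\<Sum>k<K * N. \<omega> (p k)) + h \<bullet> vec_of (p (K * N))
              \<le> real (K * N) * C + (real N * u N \<omega> + c * real N)" by linarith
        qed
        then have "last_passage_line \<omega> (K * N) h / real (K * N)
            \<le> (real (K * N) * C + (real N * u N \<omega> + c * real N)) / real (K * N)"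
          by (rule divide_right_mono) simp
        also have "\<dots> = C + u N \<omega> / real K + c / real K"
          using \<open>0 < N\<close> \<open>0 < K\<close> by (simp add: field_simps)
        finally show ?thesis .
      qed
      have "strict_mono (\<lambda>i. K * r i)"
        using r(1) \<open>0 < K\<close> by (simp add: strict_mono_def)
      from LIMSEQ_subseq_LIMSEQ[OF elim(3) this]
      have L: "(\<lambda>i. last_passage_line \<omega> (K * r i) h / real (K * r i)) \<longlonglongrightarrow> g"
        by (simp add: o_def)
      have R: "(\<lambda>i. C + u (r i) \<omega> / real K + c / real K) \<longlonglongrightarrow> C + 0 / real K + c / real K"
        using elim(2) \<open>0 < K\<close> by (intro tendsto_add tendsto_const tendsto_divide) auto
      have "\<exists>M. \<forall>i\<ge>M. last_passage_line \<omega> (K * r i) h / real (K * r i) \<le> C + u (r i) \<omega> / real K + c / real K"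
      proof (intro exI[of _ 1] allI impI)
        fix i :: nat assume "1 \<le> i"
        then have "0 < r i" using seq_suble[OF r(1), of i] by linarith
        then show "last_passage_line \<omega> (K * r i) h / real (K * r i) \<le> C + u (r i) \<omega> / real K + c / real K"
          by (rule bound)
      qed
      then show ?case using LIMSEQ_le[OF L R] by simp
    qed
    then show ?thesis by simp
  qed
  then have "\<exists>M. \<forall>K\<ge>M. g \<le> C + c / real K" by (intro exI[of _ 1]) auto
  moreover have "(\<lambda>K. C + c / real K) \<longlonglongrightarrow> C + 0"
    by (intro tendsto_add tendsto_const lim_const_over_n)
  ultimately show ?thesis using LIMSEQ_le_const[of "\<lambda>K. C + c / real K" "C + 0" g] by simp
qed

end

section \<open>The lattice direction of a point of the simplex\<close>

lemma mem_riU_iff: "\<xi> \<in> riU \<longleftrightarrow> 0 < fst \<xi> \<and> 0 < snd \<xi> \<and> fst \<xi> + snd \<xi> = 1"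
proof
  assume "\<xi> \<in> riU"
  then show "0 < fst \<xi> \<and> 0 < snd \<xi> \<and> fst \<xi> + snd \<xi> = 1"
    by (auto simp: riU_def vec_of_def e1_def e2_def)
next
  assume "0 < fst \<xi> \<and> 0 < snd \<xi> \<and> fst \<xi> + snd \<xi> = 1"
  then have "\<xi> = fst \<xi> *\<^sub>R vec_of e1 + (1 - fst \<xi>) *\<^sub>R vec_of e2 \<and> 0 < fst \<xi> \<and> fst \<xi> < 1"
    by (auto simp: vec_of_def e1_def e2_def prod_eq_iff)
  then show "\<xi> \<in> riU" unfolding riU_def by blast
qed

lemma floor_ratio_tendsto:
  fixes a :: real
  shows "(\<lambda>n. real_of_int \<lfloor>real n * a\<rfloor> / real n) \<longlonglongrightarrow> a"
proof (rule real_tendsto_sandwich)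
  show "\<forall>\<^sub>F n in sequentially. a - 1 / real n \<le> real_of_int \<lfloor>real n * a\<rfloor> / real n"
    using eventually_gt_at_top[of 0]
  proof eventually_elim
    case (elim n)
    have "a * real n \<le> real_of_int \<lfloor>real n * a\<rfloor> + 1" by (simp add: mult.commute)
    then have "a \<le> (real_of_int \<lfloor>real n * a\<rfloor> + 1) / real n"
      using elim by (simp only: pos_le_divide_eq of_nat_0_less_iff)
    then show ?case by (simp add: add_divide_distrib)
  qed
  show "\<forall>\<^sub>F n in sequentially. real_of_int \<lfloor>real n * a\<rfloor> / real n \<le> a"
    using eventually_gt_at_top[of 0]
  proof eventually_elim
    case (elim n)
    have "real_of_int \<lfloor>real n * a\<rfloor> \<le> real n * a" by linarith
    then show ?case using elim by (simp add: field_simps)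
  qed
  have "(\<lambda>n. a - 1 / real n) \<longlonglongrightarrow> a - 0"
    by (intro tendsto_diff tendsto_const lim_const_over_n)
  then show "(\<lambda>n. a - 1 / real n) \<longlonglongrightarrow> a" by simp
qed simp

lemma floor_site_riU:
  assumes "\<xi> \<in> riU"
  shows "0 \<le> fst (floor_site (real n *\<^sub>R \<xi>))" "0 \<le> snd (floor_site (real n *\<^sub>R \<xi>))"
    and "l1 (floor_site (real n *\<^sub>R \<xi>)) = fst (floor_site (real n *\<^sub>R \<xi>)) + snd (floor_site (real n *\<^sub>R \<xi>))"
    and "int n - 2 \<le> l1 (floor_site (real n *\<^sub>R \<xi>))"
proof -
  show nn: "0 \<le> fst (floor_site (real n *\<^sub>R \<xi>))" "0 \<le> snd (floor_site (real n *\<^sub>R \<xi>))"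
    using assms by (auto simp: mem_riU_iff floor_site_def)
  then show eq: "l1 (floor_site (real n *\<^sub>R \<xi>)) = fst (floor_site (real n *\<^sub>R \<xi>)) + snd (floor_site (real n *\<^sub>R \<xi>))"
    by (simp add: l1_def)
  have "real n * fst \<xi> + real n * snd \<xi> = real n"
    using assms by (simp add: mem_riU_iff flip: distrib_left)
  then show "int n - 2 \<le> l1 (floor_site (real n *\<^sub>R \<xi>))"
    unfolding eq by (simp add: floor_site_def) linarith
qed

lemma floor_site_ratio_tendsto:
  shows "(\<lambda>n. real_of_int (fst (floor_site (real n *\<^sub>R \<xi>))) / real n) \<longlonglongrightarrow> fst \<xi>"
    and "(\<lambda>n. real_of_int (snd (floor_site (real n *\<^sub>R \<xi>))) / real n) \<longlonglongrightarrow> snd \<xi>"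
  using floor_ratio_tendsto by (simp_all add: floor_site_def)

lemma l1_floor_site_ratio_tendsto:
  assumes "\<xi> \<in> riU"
  shows "(\<lambda>n. real_of_int (l1 (floor_site (real n *\<^sub>R \<xi>))) / real n) \<longlonglongrightarrow> 1"
proof -
  have "(\<lambda>n. real_of_int (fst (floor_site (real n *\<^sub>R \<xi>))) / real n
      + real_of_int (snd (floor_site (real n *\<^sub>R \<xi>))) / real n) \<longlonglongrightarrow> fst \<xi> + snd \<xi>"
    by (intro tendsto_add floor_site_ratio_tendsto)
  then show ?thesis
    using assms by (simp add: floor_site_riU(3) add_divide_distrib mem_riU_iff)
qed

lemma filterlim_l1_floor_site:
  assumes "\<xi> \<in> riU"
  shows "filterlim (\<lambda>n. l1 (floor_site (real n *\<^sub>R \<xi>))) at_top sequentially"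
  unfolding filterlim_at_top
proof
  fix Z :: int
  show "\<forall>\<^sub>F n in sequentially. Z \<le> l1 (floor_site (real n *\<^sub>R \<xi>))"
    using eventually_ge_at_top[of "nat (Z + 2)"]
  proof eventually_elim
    case (elim n)
    then show ?case using floor_site_riU(4)[OF assms, of n] by linarith
  qed
qed

text \<open>The sequence that defines \<open>g\<^sub>p\<^sub>p(\<xi>)\<close> is one of those along which the Busemann limit is
  taken.\<close>

lemma directed_between_floor_site:
  assumes "\<xi> \<in> riU" "fst \<xi>\<^sub>1 \<le> fst \<xi>" "fst \<xi> \<le> fst \<xi>\<^sub>2"
  shows "directed_between \<xi>\<^sub>1 \<xi>\<^sub>2 (\<lambda>n. floor_site (real n *\<^sub>R \<xi>))"
proof -
  let ?v = "\<lambda>n. floor_site (real n *\<^sub>R \<xi>)"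
  have "(\<lambda>n. (real_of_int (fst (?v n)) / real n) / (real_of_int (l1 (?v n)) / real n)) \<longlonglongrightarrow> fst \<xi> / 1"
    by (rule tendsto_divide[OF floor_site_ratio_tendsto(1) l1_floor_site_ratio_tendsto[OF assms(1)]]) simp
  moreover have "\<forall>\<^sub>F n in sequentially. (real_of_int (fst (?v n)) / real n) / (real_of_int (l1 (?v n)) / real n)
      = real_of_int (fst (?v n)) / real_of_int (l1 (?v n))"
    using eventually_gt_at_top[of 0] by eventually_elim simp
  ultimately have "(\<lambda>n. real_of_int (fst (?v n)) / real_of_int (l1 (?v n))) \<longlonglongrightarrow> fst \<xi>"
    unfolding div_by_1 by (rule Lim_transform_eventually)
  then have lim: "(\<lambda>n. ereal (real_of_int (fst (?v n)) / real_of_int (l1 (?v n)))) \<longlonglongrightarrow> ereal (fst \<xi>)"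
    by simp
  show ?thesis
    unfolding directed_between_def
    using floor_site_riU(1,2)[OF assms(1)] filterlim_l1_floor_site[OF assms(1)] assms(2,3)
      lim_imp_Liminf[OF _ lim] lim_imp_Limsup[OF _ lim]
    by simp
qed

section \<open>Duality and Euler's identity for the limit shapes\<close>

context iid_environment
begin

text \<open>One half of the duality \<open>g\<^sub>p\<^sub>l(h) = sup\<^sub>\<xi> (g\<^sub>p\<^sub>p(\<xi>) + h \<bullet> \<xi>)\<close>. Rounding makes the number of steps
  to the \<open>n\<close>-th lattice point differ from \<open>n\<close>, so the point-to-line limit is read off along the
  actual numbers of steps.\<close>

lemma gpp_add_inner_le_gpl:
  assumes \<xi>: "\<xi> \<in> riU" and pp: "is_pp_limit P \<xi> s" and pl: "is_pl_limit P h r"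
  shows "s + h \<bullet> \<xi> \<le> r"
proof -
  let ?v = "\<lambda>n. floor_site (real n *\<^sub>R \<xi>)"
  let ?m = "\<lambda>n. nat (l1 (?v n))"
  have m_top: "filterlim ?m at_top sequentially"
    by (rule filterlim_compose[OF filterlim_nat_sequentially filterlim_l1_floor_site[OF \<xi>]])
  have l1_nonneg: "0 \<le> l1 (?v n)" for n by (simp add: l1_def)
  have m_ratio: "(\<lambda>n. real (?m n) / real n) \<longlonglongrightarrow> 1"
    using l1_floor_site_ratio_tendsto[OF \<xi>] l1_nonneg by simp
  have vec: "(\<lambda>n. h \<bullet> vec_of (?v n) / real n) \<longlonglongrightarrow> h \<bullet> \<xi>"
  proof -
    have "(\<lambda>n. fst h * (real_of_int (fst (?v n)) / real n) + snd h * (real_of_int (snd (?v n)) / real n))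
        \<longlonglongrightarrow> fst h * fst \<xi> + snd h * snd \<xi>"
      by (intro tendsto_add tendsto_mult_left floor_site_ratio_tendsto)
    then show ?thesis by (simp add: inner_prod_def vec_of_def add_divide_distrib)
  qed
  have "AE \<omega> in P. s + h \<bullet> \<xi> \<le> r"
    using pp[unfolded is_pp_limit_def] pl[unfolded is_pl_limit_def]
  proof eventually_elim
    case (elim \<omega>)
    have L: "(\<lambda>n. last_passage \<omega> 0 (?v n) / real n + h \<bullet> vec_of (?v n) / real n) \<longlonglongrightarrow> s + h \<bullet> \<xi>"
      by (rule tendsto_add[OF elim(1) vec])
    have "(\<lambda>n. last_passage_line \<omega> (?m n) h / real (?m n) * (real (?m n) / real n)) \<longlonglongrightarrow> r * 1"
      by (rule tendsto_mult[OF filterlim_compose[OF elim(2) m_top] m_ratio])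
    moreover have "\<forall>\<^sub>F n in sequentially. 1 \<le> ?m n"
      using m_top unfolding filterlim_at_top by blast
    then have "\<forall>\<^sub>F n in sequentially. last_passage \<omega> 0 (?v n) / real n + h \<bullet> vec_of (?v n) / real n
        \<le> last_passage_line \<omega> (?m n) h / real (?m n) * (real (?m n) / real n)"
    proof eventually_elim
      case (elim n)
      have "(last_passage \<omega> 0 (?v n) + h \<bullet> vec_of (?v n)) / real n \<le> last_passage_line \<omega> (?m n) h / real n"
        by (intro divide_right_mono last_passage_line_ge_last_passage floor_site_riU[OF \<xi>]) simp
      then show ?case using elim by (simp add: add_divide_distrib)
    qed
    ultimately show ?case
      using tendsto_le[OF sequentially_bot _ L] by simp
  qed
  then show ?thesis by simp
qed

lemma gpp_scale_nat:
  assumes ex: "\<And>\<zeta>. 0 \<le> fst \<zeta> \<Longrightarrow> 0 \<le> snd \<zeta> \<Longrightarrow> \<exists>r. is_pp_limit P \<zeta> r"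
    and \<zeta>: "0 \<le> fst \<zeta>" "0 \<le> snd \<zeta>" and "0 < m"
  shows "gpp P (real m *\<^sub>R \<zeta>) = real m * gpp P \<zeta>"
proof -
  have "0 \<le> fst (real m *\<^sub>R \<zeta>)" "0 \<le> snd (real m *\<^sub>R \<zeta>)" using \<zeta> by simp_all
  note limits = is_pp_limit_gpp[OF ex[OF \<zeta>]] is_pp_limit_gpp[OF ex[OF this]]
  have "AE \<omega> in P. gpp P (real m *\<^sub>R \<zeta>) = real m * gpp P \<zeta>"
    using limits[unfolded is_pp_limit_def]
  proof eventually_elim
    case (elim \<omega>)
    have "strict_mono (\<lambda>n. n * m)" using \<open>0 < m\<close> by (simp add: strict_mono_def)
    from LIMSEQ_subseq_LIMSEQ[OF elim(1) this]
    have "(\<lambda>n. last_passage \<omega> 0 (floor_site (real n *\<^sub>R real m *\<^sub>R \<zeta>)) / real (n * m)) \<longlonglongrightarrow> gpp P \<zeta>"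
      by (simp add: o_def)
    then have "(\<lambda>n. real m * (last_passage \<omega> 0 (floor_site (real n *\<^sub>R real m *\<^sub>R \<zeta>)) / real (n * m)))
        \<longlonglongrightarrow> real m * gpp P \<zeta>"
      by (rule tendsto_mult_left)
    moreover have "real m * (a / real (n * m)) = a / real n" for a n
      using \<open>0 < m\<close> by simp
    ultimately have "(\<lambda>n. last_passage \<omega> 0 (floor_site (real n *\<^sub>R real m *\<^sub>R \<zeta>)) / real n)
        \<longlonglongrightarrow> real m * gpp P \<zeta>" by (simp only:)
    with elim(2) show ?case by (rule LIMSEQ_unique)
  qed
  then show ?thesis by simp
qed

text \<open>Homogeneity under integer factors already gives
  \<open>g\<^sub>p\<^sub>p(\<xi> + \<xi> / k) = (1 + 1 / k) g\<^sub>p\<^sub>p(\<xi>)\<close>; so the difference quotients in the radial direction with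
  increments \<open>1 / k\<close> are constant, and their limit is the radial derivative.\<close>

lemma gpp_Euler:
  assumes ex: "\<And>\<zeta>. 0 \<le> fst \<zeta> \<Longrightarrow> 0 \<le> snd \<zeta> \<Longrightarrow> \<exists>r. is_pp_limit P \<zeta> r"
    and \<xi>: "\<xi> \<in> riU" and D: "GDERIV (gpp P) \<xi> :> D"
  shows "gpp P \<xi> = D \<bullet> \<xi>"
proof -
  have "(gpp P has_derivative (\<lambda>k. k \<bullet> D)) (at (\<xi> + 0 *\<^sub>R \<xi>))"
    using D by (simp add: gderiv_def)
  moreover have "((\<lambda>t. \<xi> + t *\<^sub>R \<xi>) has_derivative (\<lambda>t. t *\<^sub>R \<xi>)) (at (0::real))"
    by (auto intro!: derivative_eq_intros)
  ultimately have "((\<lambda>t. gpp P (\<xi> + t *\<^sub>R \<xi>)) has_derivative (\<lambda>t. (t *\<^sub>R \<xi>) \<bullet> D)) (at (0::real))"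
    by (rule has_derivative_compose[rotated])
  moreover have "(\<lambda>t. (t *\<^sub>R \<xi>) \<bullet> D) = (*) (\<xi> \<bullet> D)" by (simp add: fun_eq_iff)
  ultimately have "((\<lambda>t. gpp P (\<xi> + t *\<^sub>R \<xi>)) has_real_derivative (\<xi> \<bullet> D)) (at 0)"
    by (simp only: has_field_derivative_def)
  then have "((\<lambda>t. (gpp P (\<xi> + t *\<^sub>R \<xi>) - gpp P \<xi>) / t) \<longlongrightarrow> \<xi> \<bullet> D) (at 0)"
    by (simp add: DERIV_def)
  moreover have "filterlim (\<lambda>k. 1 / real (Suc k)) (at 0) sequentially"
    by (intro filterlim_atI LIMSEQ_Suc lim_const_over_n) simp
  ultimately have lim: "(\<lambda>k. (gpp P (\<xi> + (1 / real (Suc k)) *\<^sub>R \<xi>) - gpp P \<xi>) / (1 / real (Suc k)))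
      \<longlonglongrightarrow> \<xi> \<bullet> D"
    by (rule filterlim_compose)
  have "(gpp P (\<xi> + (1 / real (Suc k)) *\<^sub>R \<xi>) - gpp P \<xi>) / (1 / real (Suc k)) = gpp P \<xi>" for k
  proof -
    let ?\<zeta> = "\<xi> + (1 / real (Suc k)) *\<^sub>R \<xi>"
    have nn: "0 \<le> fst \<xi>" "0 \<le> snd \<xi>" using \<xi> by (auto simp: mem_riU_iff)
    have "real (Suc k) *\<^sub>R ?\<zeta> = real (Suc (Suc k)) *\<^sub>R \<xi>"
      by (simp add: prod_eq_iff field_simps)
    moreover have "gpp P (real (Suc k) *\<^sub>R ?\<zeta>) = real (Suc k) * gpp P ?\<zeta>"
      using nn by (intro gpp_scale_nat ex) auto
    moreover have "gpp P (real (Suc (Suc k)) *\<^sub>R \<xi>) = real (Suc (Suc k)) * gpp P \<xi>"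
      using nn by (intro gpp_scale_nat ex) auto
    ultimately have "real (Suc k) * gpp P ?\<zeta> = real (Suc (Suc k)) * gpp P \<xi>" by simp
    then show ?thesis by (simp add: field_simps)
  qed
  then have "(\<lambda>k::nat. gpp P \<xi>) \<longlonglongrightarrow> \<xi> \<bullet> D" using lim by simp
  from LIMSEQ_unique[OF tendsto_const this] have "gpp P \<xi> = \<xi> \<bullet> D" .
  then show ?thesis by (simp add: inner_commute)
qed

end

section \<open>Variational expressions\<close>

lemma vec_of_inner_add: "h \<bullet> vec_of (x + y) = h \<bullet> vec_of x + h \<bullet> vec_of y"
  by (simp add: vec_of_def inner_prod_def algebra_simps)

lemma pp_max_eq: "pp_max P \<xi> B \<omega> = (MAX e\<in>{e1, e2}. \<omega> 0 - B \<omega> 0 e) - hvec P B \<bullet> \<xi>"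
  by (simp add: pp_max_def max_def)

text \<open>Centring cancels the tilt: \<open>h(B) \<bullet> e + h(B) \<bullet> (0 - e) = 0\<close>, while \<open>(t, t) \<bullet> e = t\<close> for both
  unit steps. So the two variational expressions differ only by constants.\<close>

lemma pl_max_centred:
  assumes "h = hvec P B + (t, t)"
  shows "pl_max h (\<lambda>\<omega> x y. hvec P B \<bullet> (vec_of x - vec_of y) - B \<omega> x y) \<omega>
    = (MAX e\<in>{e1, e2}. \<omega> 0 - B \<omega> 0 e) + t"
  by (simp add: pl_max_def assms vec_of_def e1_def e2_def max_def inner_prod_def)

lemma pl_max_eq_max:
  "pl_max h F \<omega> = max (\<omega> 0 + h \<bullet> vec_of e1 + F \<omega> 0 e1) (\<omega> 0 + h \<bullet> vec_of e2 + F \<omega> 0 e2)"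
  by (simp add: pl_max_def)

lemma minimizer_attains_INF:
  fixes f :: "'a \<Rightarrow> ereal"
  assumes "x \<in> S" "f x = v" "\<And>y. y \<in> S \<Longrightarrow> v \<le> f y"
  shows "v = (INF y\<in>S. f y)" "is_arg_min f (\<lambda>y. y \<in> S) x"
proof -
  show "v = (INF y\<in>S. f y)"
    using assms by (intro antisym INF_greatest) (auto intro: INF_lower2)
  show "is_arg_min f (\<lambda>y. y \<in> S) x"
    using assms by (auto simp: is_arg_min_def not_less)
qed

context iid_environment
begin

text \<open>Lower bounds of an essential supremum are tested on real almost sure upper bounds. This also
  covers a supremum \<open>\<infinity>\<close>, the default value for non-measurable functions included.\<close>

lemma esssup_ereal_ge:
  assumes "\<And>C. AE \<omega> in P. f \<omega> \<le> C \<Longrightarrow> g \<le> C"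
  shows "ereal g \<le> esssup P (\<lambda>\<omega>. ereal (f \<omega>))"
proof (rule ccontr)
  assume "\<not> ereal g \<le> esssup P (\<lambda>\<omega>. ereal (f \<omega>))"
  then obtain C where C: "esssup P (\<lambda>\<omega>. ereal (f \<omega>)) < ereal C" "ereal C < ereal g"
    using ereal_dense2[of "esssup P (\<lambda>\<omega>. ereal (f \<omega>))" "ereal g"] by (auto simp: not_le)
  have "AE \<omega> in P. f \<omega> \<le> C"
    using esssup_AE[of "\<lambda>\<omega>. ereal (f \<omega>)" P]
  proof eventually_elim
    case (elim \<omega>)
    then have "ereal (f \<omega>) < ereal C" using C(1) by (rule le_less_trans)
    then show ?case by simp
  qed
  from assms[OF this] C(2) show False by simp
qed

lemma esssup_ereal_AE_const:
  assumes "f \<in> borel_measurable P" "AE \<omega> in P. f \<omega> = c"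
  shows "esssup P (\<lambda>\<omega>. ereal (f \<omega>)) = ereal c"
proof (rule antisym)
  show "esssup P (\<lambda>\<omega>. ereal (f \<omega>)) \<le> ereal c"
    using assms by (intro esssup_I) auto
  show "ereal c \<le> esssup P (\<lambda>\<omega>. ereal (f \<omega>))"
  proof (rule esssup_ereal_ge)
    fix C assume "AE \<omega> in P. f \<omega> \<le> C"
    with assms(2) have "AE \<omega> in P. c \<le> C" by eventually_elim simp
    then show "c \<le> C" by simp
  qed
qed

lemma centred_cocycle:
  assumes B: "B \<in> cocycles P"
  shows "(\<lambda>\<omega> x y. hvec P B \<bullet> (vec_of x - vec_of y) - B \<omega> x y) \<in> cocycles0 P" (is "?F \<in> _")
proof -
  let ?h = "hvec P B"
  have vm [measurable]: "vec_of \<in> borel_measurable (count_space UNIV)" by simp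
  have [measurable]: "(\<lambda>(\<omega>, x, y). B \<omega> x y) \<in> borel_measurable (P \<Otimes>\<^sub>M count_space UNIV \<Otimes>\<^sub>M count_space UNIV)"
    using B by (simp add: cocycles_def)
  have "(\<lambda>p. ?h \<bullet> (vec_of (fst (snd p)) - vec_of (snd (snd p))) - (\<lambda>(\<omega>, x, y). B \<omega> x y) p)
      \<in> borel_measurable (P \<Otimes>\<^sub>M count_space UNIV \<Otimes>\<^sub>M count_space UNIV)"
    by measurable
  then have meas: "(\<lambda>(\<omega>, x, y). ?F \<omega> x y) \<in> borel_measurable (P \<Otimes>\<^sub>M count_space UNIV \<Otimes>\<^sub>M count_space UNIV)"
    by (simp add: case_prod_beta)
  have int: "integrable P (\<lambda>\<omega>. ?F \<omega> x y)" for x y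
    using cocycle_mean(1)[OF B] by simp
  have mean: "expectation (\<lambda>\<omega>. ?F \<omega> x y) = 0" for x y
    using cocycle_mean[OF B] by (simp add: inner_diff_right)
  have stat: "AE \<omega> in P. \<forall>x y z. ?F \<omega> (z + x) (z + y) = ?F (shift z \<omega>) x y"
    using cocycle_stationary[OF B]
  proof eventually_elim
    case (elim \<omega>)
    have "?F \<omega> (z + x) (z + y) = ?F (shift z \<omega>) x y" for x y z
    proof -
      have "B \<omega> (z + x) (z + y) = B (shift z \<omega>) x y" using elim by blast
      then show ?thesis by (simp add: inner_diff_right vec_of_inner_add)
    qed
    then show ?case by blast
  qed
  have add: "AE \<omega> in P. \<forall>x y z. ?F \<omega> x y + ?F \<omega> y z = ?F \<omega> x z"
    using cocycle_additive[OF B]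
  proof eventually_elim
    case (elim \<omega>)
    have "?F \<omega> x y + ?F \<omega> y z = ?F \<omega> x z" for x y z
    proof -
      have "B \<omega> x y + B \<omega> y z = B \<omega> x z" using elim by blast
      then show ?thesis by (simp add: inner_diff_right)
    qed
    then show ?case by blast
  qed
  show ?thesis
    unfolding cocycles0_def cocycles_def using meas int stat add mean by blast
qed

lemma measurable_pl_max:
  assumes "F \<in> cocycles P" shows "pl_max h F \<in> borel_measurable P"
proof -
  note [measurable] = measurable_cocycle[OF assms]
  have "(\<lambda>\<omega>. max (\<omega> 0 + h \<bullet> vec_of e1 + F \<omega> 0 e1) (\<omega> 0 + h \<bullet> vec_of e2 + F \<omega> 0 e2)) \<in> borel_measurable P"
    by measurable
  then show ?thesis by (simp add: pl_max_eq_max[abs_def])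
qed

lemma measurable_pp_max:
  assumes "B \<in> cocycles P" shows "pp_max P \<xi> B \<in> borel_measurable P"
proof -
  note [measurable] = measurable_cocycle[OF assms]
  have "(\<lambda>\<omega>. max (\<omega> 0 - B \<omega> 0 e1) (\<omega> 0 - B \<omega> 0 e2) - hvec P B \<bullet> \<xi>) \<in> borel_measurable P"
    by measurable
  then show ?thesis by (simp add: pp_max_eq[abs_def])
qed

text \<open>The limit of the dynamic programming identity \<open>last_passage_first_step\<close>. Since \<open>\<xi>\<close> has
  positive coordinates, both neighbours of the origin eventually lie below the endpoint.\<close>

lemma busemann_recovers_weight:
  assumes \<xi>: "\<xi> \<in> riU"
    and lim: "AE \<omega> in P. \<forall>x y. (\<lambda>n. last_passage \<omega> x (floor_site (real n *\<^sub>R \<xi>))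
      - last_passage \<omega> y (floor_site (real n *\<^sub>R \<xi>))) \<longlonglongrightarrow> B \<omega> x y"
  shows "AE \<omega> in P. (MAX e\<in>{e1, e2}. \<omega> 0 - B \<omega> 0 e) = 0"
  using lim
proof eventually_elim
  case (elim \<omega>)
  let ?v = "\<lambda>n. floor_site (real n *\<^sub>R \<xi>)"
  let ?d = "\<lambda>n e. \<omega> 0 - (last_passage \<omega> 0 (?v n) - last_passage \<omega> e (?v n))"
  have d: "(\<lambda>n. ?d n e) \<longlonglongrightarrow> \<omega> 0 - B \<omega> 0 e" for e
    using elim by (intro tendsto_diff tendsto_const) blast
  have pos: "\<forall>\<^sub>F n in sequentially. 1 \<le> \<lfloor>real n * a\<rfloor>" if "0 < a" for a
  proof -
    have "\<forall>\<^sub>F n in sequentially. 1 / a \<le> real n"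
      using filterlim_real_sequentially unfolding filterlim_at_top by blast
    then show ?thesis
    proof eventually_elim
      case (elim n)
      then have "1 \<le> real n * a" using that by (simp add: field_simps)
      then show ?case by linarith
    qed
  qed
  have \<xi>_pos: "0 < fst \<xi>" "0 < snd \<xi>" using \<xi> by (simp_all add: mem_riU_iff)
  have "\<forall>\<^sub>F n in sequentially. max (?d n e1) (?d n e2) = 0"
    using pos[OF \<xi>_pos(1)] pos[OF \<xi>_pos(2)]
  proof eventually_elim
    case (elim n)
    then have "last_passage \<omega> 0 (?v n) = \<omega> 0 + (MAX e\<in>{e1, e2}. last_passage \<omega> (0 + e) (?v n))"
      by (intro last_passage_first_step) (auto simp: floor_site_def)
    then show ?case by (auto simp: max_def)
  qed
  then have "(\<lambda>n. max (?d n e1) (?d n e2)) \<longlonglongrightarrow> 0" by (rule tendsto_eventually)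
  moreover have "(\<lambda>n. max (?d n e1) (?d n e2)) \<longlonglongrightarrow> max (\<omega> 0 - B \<omega> 0 e1) (\<omega> 0 - B \<omega> 0 e2)"
    by (intro tendsto_max d)
  ultimately have "max (\<omega> 0 - B \<omega> 0 e1) (\<omega> 0 - B \<omega> 0 e2) = 0"
    by (rule LIMSEQ_unique[rotated])
  then show ?case by simp
qed

end

theorem theorem3p2:
  fixes P :: "env measure"
    and \<xi> \<xi>_lower \<xi>_upper :: "real \<times> real"
    and B F :: "env \<Rightarrow> site \<Rightarrow> site \<Rightarrow> real"
  assumes "iid_environment P"
    and pp_limit_exists: "\<And>\<zeta>. 0 \<le> fst \<zeta> \<Longrightarrow> 0 \<le> snd \<zeta> \<Longrightarrow> \<exists>r. is_pp_limit P \<zeta> r"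
    and pl_limit_exists: "\<And>h. \<exists>r. is_pl_limit P h r"
    and "\<xi> \<in> riU"
    and "U_set P \<xi> = closed_segment \<xi>_lower \<xi>_upper" "fst \<xi>_lower \<le> fst \<xi>_upper"
    and "\<xi>_lower \<in> Diff_set P" "\<xi> \<in> Diff_set P" "\<xi>_upper \<in> Diff_set P"
    and "B \<in> cocycles P"
    and B_limit: "\<And>v. directed_between \<xi>_lower \<xi>_upper v \<Longrightarrow>
           AE \<omega> in P. \<forall>x y. (\<lambda>n. last_passage \<omega> x (v n) - last_passage \<omega> y (v n))
             \<longlonglongrightarrow> B \<omega> x y"
    and B_gradient: "GDERIV (gpp P) \<xi> :> - hvec P B"
    and F_def: "F = (\<lambda>\<omega> x y. hvec P B \<bullet> (vec_of x - vec_of y) - B \<omega> x y)"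
  shows
    "(\<forall>t h. h = hvec P B + (t, t) \<longrightarrow>
        (AE \<omega> in P. gpl P h = pl_max h F \<omega> \<and> pl_max h F \<omega> = t) \<and>
        ereal (gpl P h) = (INF F'\<in>cocycles0 P. esssup P (\<lambda>\<omega>. ereal (pl_max h F' \<omega>))) \<and>
        is_arg_min (\<lambda>F'. esssup P (\<lambda>\<omega>. ereal (pl_max h F' \<omega>))) (\<lambda>F'. F' \<in> cocycles0 P) F) \<and>
     (AE \<omega> in P. gpp P \<xi> = pp_max P \<xi> B \<omega> \<and> pp_max P \<xi> B \<omega> = - (hvec P B \<bullet> \<xi>)) \<and>
     ereal (gpp P \<xi>) = (INF B'\<in>cocycles P. esssup P (\<lambda>\<omega>. ereal (pp_max P \<xi> B' \<omega>))) \<and>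
     is_arg_min (\<lambda>B'. esssup P (\<lambda>\<omega>. ereal (pp_max P \<xi> B' \<omega>))) (\<lambda>B'. B' \<in> cocycles P) B"
proof -
  interpret iid_environment P by fact
  note \<xi> = \<open>\<xi> \<in> riU\<close> and B = \<open>B \<in> cocycles P\<close>
  note pl = is_pl_limit_gpl[OF pl_limit_exists]
  have pp: "is_pp_limit P \<xi> (gpp P \<xi>)"
    using \<xi> by (intro is_pp_limit_gpp pp_limit_exists) (auto simp: mem_riU_iff)
  have "\<xi> \<in> closed_segment \<xi>_lower \<xi>_upper"
    using \<xi> unfolding assms(5)[symmetric] by (simp add: U_set_def U_plus_def)
  then obtain u where u: "0 \<le> u" "u \<le> 1" "\<xi> = (1 - u) *\<^sub>R \<xi>_lower + u *\<^sub>R \<xi>_upper"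
    unfolding closed_segment_def by blast
  have "fst \<xi> \<in> closed_segment (fst \<xi>_lower) (fst \<xi>_upper)"
    using u unfolding closed_segment_def by auto
  then have "fst \<xi>_lower \<le> fst \<xi>" "fst \<xi> \<le> fst \<xi>_upper"
    using assms(6) by (auto simp: closed_segment_eq_real_ivl)
  from busemann_recovers_weight[OF \<xi> B_limit[OF directed_between_floor_site[OF \<xi> this]]]
  have recovery: "AE \<omega> in P. (MAX e\<in>{e1, e2}. \<omega> 0 - B \<omega> 0 e) = 0" .
  have euler: "gpp P \<xi> = - (hvec P B \<bullet> \<xi>)"
    using gpp_Euler[OF pp_limit_exists \<xi> B_gradient] by simp
  have F0: "F \<in> cocycles0 P" unfolding F_def by (rule centred_cocycle[OF B])
  then have FK: "F \<in> cocycles P" by (simp add: cocycles0_def)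

  have part1: "(AE \<omega> in P. gpl P h = pl_max h F \<omega> \<and> pl_max h F \<omega> = t) \<and>
      ereal (gpl P h) = (INF F'\<in>cocycles0 P. esssup P (\<lambda>\<omega>. ereal (pl_max h F' \<omega>))) \<and>
      is_arg_min (\<lambda>F'. esssup P (\<lambda>\<omega>. ereal (pl_max h F' \<omega>))) (\<lambda>F'. F' \<in> cocycles0 P) F"
    if h: "h = hvec P B + (t, t)" for t h
  proof -
    have const: "AE \<omega> in P. pl_max h F \<omega> = t"
      using recovery unfolding F_def pl_max_centred[OF h] by eventually_elim simp
    have "gpl P h \<le> t"
      using const by (intro gpl_le_cocycle_bound[OF F0 _ pl]) auto
    moreover have "t \<le> gpl P h"
    proof -
      have "h \<bullet> \<xi> = hvec P B \<bullet> \<xi> + t * (fst \<xi> + snd \<xi>)"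
        unfolding h by (simp add: inner_prod_def algebra_simps)
      then show ?thesis
        using gpp_add_inner_le_gpl[OF \<xi> pp pl, of h] euler \<xi> by (simp add: mem_riU_iff)
    qed
    ultimately have gpl: "gpl P h = t" by simp
    have ess: "esssup P (\<lambda>\<omega>. ereal (pl_max h F \<omega>)) = ereal (gpl P h)"
      using esssup_ereal_AE_const[OF measurable_pl_max[OF FK] const] gpl by simp
    have low: "ereal (gpl P h) \<le> esssup P (\<lambda>\<omega>. ereal (pl_max h F' \<omega>))" if "F' \<in> cocycles0 P" for F'
      by (rule esssup_ereal_ge) (rule gpl_le_cocycle_bound[OF that _ pl])
    show ?thesis
      using const gpl minimizer_attains_INF[of F "cocycles0 P" "\<lambda>F'. esssup P (\<lambda>\<omega>. ereal (pl_max h F' \<omega>))", OF F0 ess low] by auto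
  qed

  have const: "AE \<omega> in P. pp_max P \<xi> B \<omega> = gpp P \<xi>"
    using recovery unfolding pp_max_eq euler by eventually_elim simp
  have ess: "esssup P (\<lambda>\<omega>. ereal (pp_max P \<xi> B \<omega>)) = ereal (gpp P \<xi>)"
    by (rule esssup_ereal_AE_const[OF measurable_pp_max[OF B] const])
  have low: "ereal (gpp P \<xi>) \<le> esssup P (\<lambda>\<omega>. ereal (pp_max P \<xi> B' \<omega>))" if B': "B' \<in> cocycles P" for B'
  proof (rule esssup_ereal_ge)
    fix C assume C: "AE \<omega> in P. pp_max P \<xi> B' \<omega> \<le> C"
    \<comment> \<open>The tilt \<open>h(B')\<close> is the one for which the centred competitor bounds \<open>g\<^sub>p\<^sub>l\<close> by \<open>C + h(B') \<bullet> \<xi>\<close>.\<close>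
    let ?h = "hvec P B'"
    have h0: "?h = ?h + (0, 0)" by (simp flip: zero_prod_def)
    have "gpl P ?h \<le> C + ?h \<bullet> \<xi>"
    proof (rule gpl_le_cocycle_bound[OF centred_cocycle[OF B'] _ pl])
      show "AE \<omega> in P. pl_max ?h (\<lambda>\<omega> x y. ?h \<bullet> (vec_of x - vec_of y) - B' \<omega> x y) \<omega> \<le> C + ?h \<bullet> \<xi>"
        unfolding pl_max_centred[OF h0] using C unfolding pp_max_eq by eventually_elim linarith
    qed
    then show "gpp P \<xi> \<le> C"
      using gpp_add_inner_le_gpl[OF \<xi> pp pl, of ?h] by simp
  qed
  note part2 = minimizer_attains_INF[of B "cocycles P" "\<lambda>B'. esssup P (\<lambda>\<omega>. ereal (pp_max P \<xi> B' \<omega>))", OF B ess low]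
  have eq: "AE \<omega> in P. gpp P \<xi> = pp_max P \<xi> B \<omega> \<and> pp_max P \<xi> B \<omega> = - (hvec P B \<bullet> \<xi>)"
    using const euler by auto
  show ?thesis
    by (intro conjI eq part2) (intro allI impI, rule part1)
qed

end
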